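(* For every integer $q\geq 2$, every fixed integer $t\geq 1$, and every real $\rho\in[0,1]$, \[ \kappa_t(\rho,q)= \begin{cases} 1-H_{q^t}(\rho), & 0\leq\rho<1-q^{-t},\\ 0, & 1-q^{-t}\leq\rho\leq 1. \end{cases} \]
   Context: For an integer $Q\ge 2$ and $x\in[0,1]$, the $Q$-ary entropy function is $H_Q(x):=x\log_Q(Q-1)-x\log_Q x-(1-x)\log_Q(1-x)$, with $0\log_Q 0=0$. Let $G_q$ be an abelian group of order $q$ (only its cardinality matters for the quantities below). $G_q^{t\times n}$ denotes the set of $t\times n$ matrices with entries in $G_q$. The $t$-weight $\mathrm{wt}^{(t)}(\mathbf v)$ of $\mathbf v\in G_q^{t\times n}$ is the number of nonzero columns of $\mathbf v$, and the $t$-distance is $d^{(t)}(\mathbf v,\mathbf u):=\mathrm{wt}^{(t)}(\mathbf v-\mathbf u)$, i.e. the number of columns in which $\mathbf v$ and $\mathbf u$ differ. For a nonempty code $C\subseteq G_q^n$, $C^t\subseteq G_q^{t\times n}$ is the set of $t\times n$ matrices all of whose rows belong to $C$, and the $t$-th covering radius of $C$ is \[ R_t(C):=\max_{\mathbf u\in G_q^{t\times n}}\ \min_{\mathbf c\in C^t} d^{(t)}(\mathbf c,\mathbf u). \] For integers $n,t\ge1$, $q\geq 2$ and real $0\le r\le n$, define \[ k_t(n,r,q):=\min\{\log_q|C| : \emptyset\neq C\subseteq G_q^n,\ R_t(C)\leq r\}, \] and for $\rho\in[0,1]$ define \[ \kappa_t(\rho,q):=\liminf_{n\to\infty}\frac{k_t(n,\rho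 n,q)}{n}. \] *)

theory Defs
  imports Complex_Main "HOL-Library.FuncSet" "HOL-Library.Extended_Real" "HOL-Algebra.Group"
begin

text \<open>The convention \<open>0 log 0 = 0\<close> holds automatically, since the logarithm is total.\<close>

definition entropy_fun :: "nat \<Rightarrow> real \<Rightarrow> real" where
  "entropy_fun Q x =
     x * log (real Q) (real Q - 1) - x * log (real Q) x - (1 - x) * log (real Q) (1 - x)"

text \<open>
  The alphabet is a finite abelian group, written multiplicatively as in HOL-Algebra, so that
  ``nonzero'' reads ``different from \<open>\<one>\<close>'' and the difference of \<open>x\<close> and \<open>y\<close> is \<open>x \<otimes> inv y\<close>.
  Words of length \<open>n\<close> are extensional functions on \<open>{..<n}\<close>; a \<open>t \<times> n\<close> matrix is an extensional
  function on \<open>{..<t}\<close> that maps each row index to the corresponding row.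
\<close>

definition code_words :: "('a, 'b) monoid_scheme \<Rightarrow> nat \<Rightarrow> (nat \<Rightarrow> 'a) set" where
  "code_words G n = {..<n} \<rightarrow>\<^sub>E carrier G"

definition code_matrices ::
    "('a, 'b) monoid_scheme \<Rightarrow> nat \<Rightarrow> nat \<Rightarrow> (nat \<Rightarrow> nat \<Rightarrow> 'a) set" where
  "code_matrices G t n = {..<t} \<rightarrow>\<^sub>E code_words G n"

definition matrix_diff ::
    "('a, 'b) monoid_scheme \<Rightarrow> nat \<Rightarrow> nat \<Rightarrow> (nat \<Rightarrow> nat \<Rightarrow> 'a) \<Rightarrow> (nat \<Rightarrow> nat \<Rightarrow> 'a) \<Rightarrow>
     (nat \<Rightarrow> nat \<Rightarrow> 'a)" where
  "matrix_diff G t n v u =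
     (\<lambda>i\<in>{..<t}. \<lambda>j\<in>{..<n}. v i j \<otimes>\<^bsub>G\<^esub> inv\<^bsub>G\<^esub> (u i j))"

definition t_weight ::
    "('a, 'b) monoid_scheme \<Rightarrow> nat \<Rightarrow> nat \<Rightarrow> (nat \<Rightarrow> nat \<Rightarrow> 'a) \<Rightarrow> nat" where
  "t_weight G t n v = card {j \<in> {..<n}. \<exists>i<t. v i j \<noteq> \<one>\<^bsub>G\<^esub>}"

definition t_distance ::
    "('a, 'b) monoid_scheme \<Rightarrow> nat \<Rightarrow> nat \<Rightarrow> (nat \<Rightarrow> nat \<Rightarrow> 'a) \<Rightarrow> (nat \<Rightarrow> nat \<Rightarrow> 'a) \<Rightarrow> nat" where
  "t_distance G t n v u = t_weight G t n (matrix_diff G t n v u)"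

definition code_power ::
    "('a, 'b) monoid_scheme \<Rightarrow> nat \<Rightarrow> nat \<Rightarrow> (nat \<Rightarrow> 'a) set \<Rightarrow> (nat \<Rightarrow> nat \<Rightarrow> 'a) set" where
  "code_power G t n C = {c \<in> code_matrices G t n. \<forall>i<t. c i \<in> C}"

definition covering_radius ::
    "('a, 'b) monoid_scheme \<Rightarrow> nat \<Rightarrow> nat \<Rightarrow> (nat \<Rightarrow> 'a) set \<Rightarrow> nat" where
  "covering_radius G t n C =
     Max ((\<lambda>u. Min ((\<lambda>c. t_distance G t n c u) ` code_power G t n C)) ` code_matrices G t n)"

definition min_log_size :: "('a, 'b) monoid_scheme \<Rightarrow> nat \<Rightarrow> nat \<Rightarrow> real \<Rightarrow> real" where
  "min_log_size G t n r =
     Min {log (real (card (carrier G))) (real (card C)) | C.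
            C \<noteq> {} \<and> C \<subseteq> code_words G n \<and> real (covering_radius G t n C) \<le> r}"

text \<open>
  The value is an extended real, so that the lower limit is meaningful without any prior
  boundedness argument. The term at \<open>n = 0\<close> does not affect it.
\<close>

definition min_rate :: "('a, 'b) monoid_scheme \<Rightarrow> nat \<Rightarrow> real \<Rightarrow> ereal" where
  "min_rate G t \<rho> = liminf (\<lambda>n. ereal (min_log_size G t n (\<rho> * real n) / real n))"

end

theory Submission
  imports Defs "HOL-Real_Asymp.Real_Asymp"
begin

text \<open>
  The lower bound is sphere covering: the \<open>|C| ^ t\<close> balls around \<open>C ^ t\<close> must exhaust the matrices.

  For the upper bound take \<open>n = t * m\<close> and let \<open>E\<close> be the set of \<open>t\<close>-tuples of words of length \<open>m\<close> with at
  most \<open>\<rho> * m\<close> nonzero columns, viewed as a tree of depth \<open>t\<close>. Up to a factor polynomial in \<open>m\<close>, \<open>E\<close> contains a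
  regular subtree with degrees \<open>k\<^sub>1, \<dots>, k\<^sub>t\<close> and about \<open>|E|\<close> leaves. A greedily chosen set \<open>D\<^sub>j\<close> of about
  \<open>q ^ m / k\<^sub>j\<close> words meets all sets \<open>u - S\<close>, where \<open>S\<close> is the set of children of a node of level \<open>j\<close>. So,
  walking down the tree, every \<open>t\<close>-tuple of words is the sum of an element of \<open>D\<^sub>1 \<times> \<dots> \<times> D\<^sub>t\<close> and one of \<open>E\<close>.
  The sets \<open>D\<^sub>j\<close> may have different sizes; rotating the roles of the rows over \<open>t\<close> blocks
  gives each row a code of size \<open>\<Prod>\<^sub>j |D\<^sub>j| \<approx> q ^ (t * m) / |E|\<close>, and \<open>C\<close> is the union of these \<open>t\<close> codes.\<close>

subsection \<open>Hitting sets and regular subtrees\<close>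

text \<open>Double counting of the pairs \<open>x \<in> S\<close>: each \<open>S\<close> contributes
  at least \<open>k\<close>, so an average point of \<open>X\<close> lies in at least a
  \<open>k / card X\<close> fraction of \<open>R\<close>.\<close>

lemma greedy_hitting_step:
  fixes X :: "'a set" and R :: "'a set set"
  assumes X: "finite X" and R: "finite R" and k: "0 < k"
    and S: "\<And>S. S \<in> R \<Longrightarrow> S \<subseteq> X \<and> k \<le> card S"
    and "R \<noteq> {}"
  shows "\<exists>x\<in>X. real (card R) * (real k / real (card X)) \<le> real (card {S \<in> R. x \<in> S})"
proof (rule ccontr)
  assume "\<not> ?thesis"
  then have less: "real (card {S \<in> R. x \<in> S}) < real (card R) * (real k / real (card X))"
    if "x \<in> X" for x using that by force
  obtain S0 where "S0 \<in> R" using \<open>R \<noteq> {}\<close> by blast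
  with S k have "X \<noteq> {}" by fastforce
  then have X0: "card X > 0" using X by (simp add: card_gt_0_iff)
  have "(\<Sum>x\<in>X. card {S \<in> R. x \<in> S}) = (\<Sum>S\<in>R. card {x \<in> X. x \<in> S})"
    by (rule sum_multicount_gen) (use X R in auto)
  also have "\<dots> \<ge> (\<Sum>S\<in>R. k)"
  proof (rule sum_mono)
    fix S' assume "S' \<in> R"
    then have "{x \<in> X. x \<in> S'} = S'" "k \<le> card S'" using S by auto
    then show "k \<le> card {x \<in> X. x \<in> S'}" by simp
  qed
  finally have "card R * k \<le> (\<Sum>x\<in>X. card {S \<in> R. x \<in> S})" by simp
  then have "real (card R * k) \<le> real (\<Sum>x\<in>X. card {S \<in> R. x \<in> S})"
    by (rule of_nat_mono)
  also have "\<dots> = (\<Sum>x\<in>X. real (card {S \<in> R. x \<in> S}))" by simp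
  also have "\<dots> < (\<Sum>x\<in>X. real (card R) * (real k / real (card X)))"
    by (rule sum_strict_mono) (use X \<open>X \<noteq> {}\<close> less in auto)
  also have "\<dots> = real (card R * k)" using X0 by simp
  finally show False by simp
qed

text \<open>Each greedy point hits at least a \<open>k / card X\<close> fraction of the sets still
  missed, so their number decays geometrically.\<close>

lemma greedy_hitting_set:
  fixes X :: "'a set" and F :: "'a set set"
  assumes X: "finite X" and F: "finite F" and k: "0 < k"
    and S: "\<And>S. S \<in> F \<Longrightarrow> S \<subseteq> X \<and> k \<le> card S"
    and kX: "k \<le> card X"
  shows "\<exists>D\<subseteq>X. card D \<le> s \<and>
    real (card {S \<in> F. S \<inter> D = {}}) \<le> real (card F) * (1 - real k / real (card X)) ^ s"
proof (induction s)
  case 0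
  show ?case by (rule exI[of _ "{}"]) simp
next
  case (Suc s)
  define p where "p = 1 - real k / real (card X)"
  have p: "0 \<le> p" using k kX by (simp add: p_def)
  from Suc obtain D where D: "D \<subseteq> X" "card D \<le> s"
    "real (card {S \<in> F. S \<inter> D = {}}) \<le> real (card F) * p ^ s" unfolding p_def by blast
  define R where "R = {S \<in> F. S \<inter> D = {}}"
  have fR: "finite R" using F by (simp add: R_def)
  show ?case
  proof (cases "R = {}")
    \<comment> \<open>Nothing is missed any more and \<open>D\<close> is kept, whence
      \<open>card D \<le> s\<close> rather than equality.\<close>
    case True
    then have "card {S \<in> F. S \<inter> D = {}} = 0" unfolding R_def by (metis card.empty)
    then have "real (card {S \<in> F. S \<inter> D = {}}) \<le> real (card F) * p ^ Suc s"
      using p by (metis mult_nonneg_nonneg of_nat_0 of_nat_0_le_iff zero_le_power)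
    then show ?thesis using D(1,2) unfolding p_def by (intro exI[of _ D]) simp
  next
    case False
    obtain x where x: "x \<in> X" "real (card R) * (real k / real (card X)) \<le> real (card {S \<in> R. x \<in> S})"
      using greedy_hitting_step[OF X fR k _ False] S by (auto simp: R_def)
    have "card {S \<in> F. S \<inter> insert x D = {}} + card {S \<in> R. x \<in> S} = card R"
    proof -
      have "R = {S \<in> F. S \<inter> insert x D = {}} \<union> {S \<in> R. x \<in> S}" by (auto simp: R_def)
      moreover have "{S \<in> F. S \<inter> insert x D = {}} \<inter> {S \<in> R. x \<in> S} = {}" by auto
      ultimately show ?thesis using fR
        by (metis card_Un_disjoint finite_Un)
    qed
    then have "real (card {S \<in> F. S \<inter> insert x D = {}}) = real (card R) - real (card {S \<in> R. x \<in> S})"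
      by linarith
    also have "\<dots> \<le> real (card R) * p" using x(2) by (simp add: p_def algebra_simps)
    also have "\<dots> \<le> real (card F) * p ^ s * p" using D(3) p by (intro mult_right_mono) (auto simp: R_def)
    finally have "real (card {S \<in> F. S \<inter> insert x D = {}}) \<le> real (card F) * p ^ Suc s"
      by (simp add: mult_ac)
    moreover have "card (insert x D) \<le> Suc s"
      using D(2) card_insert_le_m1[of "Suc s" D x] by simp
    ultimately show ?thesis using D(1) x(1) unfolding p_def
      by (intro exI[of _ "insert x D"]) auto
  qed
qed

text \<open>After slightly more than \<open>card X / k * ln B\<close> greedy points fewer than one
  set is missed, hence none. Allowing any \<open>B\<close> above \<open>card F\<close> lets one
  value serve all levels of a tree.\<close>

lemma hitting_set:
  fixes X :: "'a set" and F :: "'a set set" and B :: real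
  assumes X: "finite X" and F: "finite F" and k: "0 < k"
    and S: "\<And>S. S \<in> F \<Longrightarrow> S \<subseteq> X \<and> k \<le> card S"
    and B: "real (card F) \<le> B" "1 \<le> B"
  shows "\<exists>D\<subseteq>X. (\<forall>S\<in>F. S \<inter> D \<noteq> {}) \<and> real (card D) \<le> real (card X) / real k * (ln B + 1)"
proof (cases "F = {}")
  case True
  then show ?thesis using B by (intro exI[of _ "{}"]) auto
next
  case False
  then obtain S0 where "S0 \<in> F" by blast
  then have kX: "k \<le> card X" using S[of S0] card_mono[OF X] by (meson order_trans)
  define r where "r = real (card X) / real k"
  have r: "1 \<le> r" using k kX by (simp add: r_def)
  \<comment> \<open>\<open>s\<close> strictly exceeds \<open>r * ln B\<close>, which makes
    \<open>exp (- s / r) < 1 / B\<close>; the extra point is absorbed because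
    \<open>1 \<le> r\<close>.\<close>
  define s where "s = nat \<lfloor>r * ln B\<rfloor> + 1"
  have lnB: "0 \<le> ln B" using B by simp
  have "0 \<le> r * ln B" using r lnB by simp
  then have "real s = of_int \<lfloor>r * ln B\<rfloor> + 1" unfolding s_def by simp
  then have s1: "real s > r * ln B" and s2: "real s \<le> r * ln B + 1" by linarith+
  obtain D where D: "D \<subseteq> X" "card D \<le> s"
    "real (card {S \<in> F. S \<inter> D = {}}) \<le> real (card F) * (1 - real k / real (card X)) ^ s"
    using greedy_hitting_set[OF X F k S kX, of s] by blast
  have eq: "real k / real (card X) = 1 / r" by (simp add: r_def)
  have "(1 - 1 / r) ^ s \<le> exp (- (1 / r)) ^ s"
    using r exp_ge_add_one_self[of "- (1/r)"] by (intro power_mono) auto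
  also have "\<dots> = exp (- (real s / r))" by (simp add: exp_of_nat_mult[symmetric])
  also have "\<dots> < exp (- ln B)" using s1 r by (simp add: field_simps)
  also have "\<dots> = 1 / B" using B by (simp add: exp_minus divide_inverse)
  finally have "(1 - 1 / r) ^ s < 1 / B" .
  then have "B * (1 - 1 / r) ^ s < 1" using B by (simp add: field_simps)
  moreover have "real (card {S \<in> F. S \<inter> D = {}}) \<le> B * (1 - 1 / r) ^ s"
  proof -
    have "real (card F) * (1 - 1 / r) ^ s \<le> B * (1 - 1 / r) ^ s"
      using B(1) r by (intro mult_right_mono) auto
    then show ?thesis using D(3) unfolding eq by linarith
  qed
  ultimately have "card {S \<in> F. S \<inter> D = {}} = 0" by linarith
  then have "{S \<in> F. S \<inter> D = {}} = {}" using F by simp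
  moreover have "real (card D) \<le> r * (ln B + 1)"
    using D(2) s2 r by (simp add: algebra_simps)
  ultimately show ?thesis using D(1) unfolding r_def by blast
qed

section \<open>Prefix trees with prescribed degrees\<close>

text \<open>\<open>E\<close> is read as the leaves of a prefix tree, with
  \<open>{xs. x # xs \<in> E}\<close> the subtree below \<open>x\<close>. The predicate asks for a
  subtree in which all nodes of one level have at least the degree listed for that level.\<close>

primrec branching :: "'a set \<Rightarrow> nat list \<Rightarrow> 'a list set \<Rightarrow> bool" where
  "branching X [] E \<longleftrightarrow> [] \<in> E"
| "branching X (k # ks) E \<longleftrightarrow> k \<le> card {x \<in> X. branching X ks {xs. x # xs \<in> E}}"

text \<open>Pruning from the leaves up: with degrees rounded down to powers of 2, at most \<open>(L + 1) ^ t\<close> degree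
  sequences occur among the subtrees below the root, and one of them carries a
  \<open>1 / (L + 1) ^ t\<close> fraction of the leaves.\<close>

lemma branching_subtree:
  fixes X :: "'a set"
  assumes X: "finite X" and L: "card X \<le> 2 ^ L"
  shows "t \<le> T \<Longrightarrow> E \<subseteq> {xs. set xs \<subseteq> X \<and> length xs = t} \<Longrightarrow> E \<noteq> {} \<Longrightarrow>
    \<exists>as. length as = t \<and> set as \<subseteq> {..L} \<and> branching X (map ((^) 2) as) E \<and>
      card E \<le> (\<Prod>a\<leftarrow>as. 2 ^ a) * (2 * (L + 1) ^ T) ^ t"
proof (induction t arbitrary: E)
  case 0
  then have "E = {[]}" by auto
  then show ?case by simp
next
  case (Suc t)
  define W where "W x = {xs. x # xs \<in> E}" for x
  define Y where "Y = {x \<in> X. W x \<noteq> {}}"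
  \<comment> \<open>The loss over \<open>t\<close> levels: on each, a factor 2 for rounding and at
    most \<open>(L + 1) ^ T\<close> for the choice of a degree sequence. The fixed \<open>T\<close>
    makes this factor the same on all levels.\<close>
  define c where "c = (2 * (L + 1) ^ T) ^ t"
  define A where "A = {as. set as \<subseteq> {..L} \<and> length as = t}"
  have fin: "finite {xs. set xs \<subseteq> X \<and> length xs = n}" for n
    using X by (rule finite_lists_length_eq)
  have W: "W x \<subseteq> {xs. set xs \<subseteq> X \<and> length xs = t}" for x
    using Suc.prems(2) unfolding W_def by force
  have fW: "finite (W x)" for x using W fin by (rule finite_subset)
  have fY: "finite Y" using X by (simp add: Y_def)
  have fA: "finite A" unfolding A_def by (rule finite_lists_length_eq) simp
  have cA: "card A = (L + 1) ^ t" unfolding A_def by (subst card_lists_length_eq) auto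
  have "\<forall>x\<in>Y. \<exists>as. as \<in> A \<and> branching X (map ((^) 2) as) (W x) \<and>
      card (W x) \<le> (\<Prod>a\<leftarrow>as. 2 ^ a) * c"
    using Suc.IH[OF _ W] Suc.prems(1) unfolding Y_def A_def c_def by fastforce
  then obtain g where g: "\<And>x. x \<in> Y \<Longrightarrow> g x \<in> A \<and> branching X (map ((^) 2) (g x)) (W x) \<and>
      card (W x) \<le> (\<Prod>a\<leftarrow>g x. 2 ^ a) * c" by metis
  \<comment> \<open>\<open>P as\<close> is the number of leaves of a regular tree with degrees
    \<open>2 ^ a\<close>; \<open>N as\<close> counts the children of the root whose subtree was
    assigned \<open>as\<close>.\<close>
  define P :: "nat list \<Rightarrow> nat" where "P as = (\<Prod>a\<leftarrow>as. 2 ^ a)" for as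
  define N where "N as = card {x \<in> Y. g x = as}" for as
  have "E = (\<Union>x\<in>Y. (#) x ` W x)"
  proof (intro equalityI subsetI)
    fix ys assume "ys \<in> E"
    moreover from this obtain x xs where "ys = x # xs" "x \<in> X"
      using Suc.prems(2) by (cases ys) auto
    ultimately show "ys \<in> (\<Union>x\<in>Y. (#) x ` W x)" unfolding Y_def W_def by blast
  qed (auto simp: W_def)
  then have "card E \<le> (\<Sum>x\<in>Y. card ((#) x ` W x))"
    using card_UN_le[OF fY] by metis
  also have "\<dots> = (\<Sum>x\<in>Y. card (W x))" by (simp add: card_image)
  also have "\<dots> \<le> (\<Sum>x\<in>Y. P (g x) * c)" using g by (intro sum_mono) (auto simp: P_def)
  also have "\<dots> = (\<Sum>as\<in>A. \<Sum>x\<in>{x \<in> Y. g x = as}. P (g x) * c)"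
    by (rule sum.group[symmetric]) (use fY fA g in auto)
  also have "\<dots> = (\<Sum>as\<in>A. N as * P as * c)" by (intro sum.cong) (auto simp: N_def)
  finally have E_le: "card E \<le> (\<Sum>as\<in>A. N as * P as * c)" .
  \<comment> \<open>Pigeonhole: the largest of the \<open>card A\<close> summands is at least their
    average.\<close>
  have "\<exists>as\<in>A. card E \<le> card A * (N as * P as * c)"
  proof (rule ccontr)
    assume "\<not> ?thesis"
    then have *: "card A * (N as * P as * c) < card E" if "as \<in> A" for as using that by force
    have "A \<noteq> {}" using cA by (metis card.empty power_eq_0_iff Suc_eq_plus1 nat.distinct(1))
    then have "(\<Sum>as\<in>A. card A * (N as * P as * c)) < (\<Sum>as\<in>A. card E)"
      by (intro sum_strict_mono) (use fA * in auto)
    then have "card A * (\<Sum>as\<in>A. N as * P as * c) < card A * card E"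
      by (simp add: sum_distrib_left)
    then show False using E_le by simp
  qed
  then obtain as where as: "as \<in> A" "card E \<le> card A * (N as * P as * c)" by blast
  have "finite E" using Suc.prems(2) fin by (rule finite_subset)
  then have "card E > 0" using Suc.prems(3) by (simp add: card_gt_0_iff)
  then have N0: "N as > 0" using as(2) by (cases "N as") auto
  \<comment> \<open>Rounding the degree \<open>N as\<close> down to a power of 2 costs less than a
    factor 2.\<close>
  then obtain a where a: "2 ^ a \<le> N as" "N as < 2 ^ (a + 1)"
    using ex_power_ivl1[of 2 "N as"] by auto
  have sub: "{x \<in> Y. g x = as} \<subseteq> {x \<in> X. branching X (map ((^) 2) as) (W x)}"
    using g by (auto simp: Y_def)
  have "N as \<le> card {x \<in> X. branching X (map ((^) 2) as) (W x)}"
    unfolding N_def by (rule card_mono[OF _ sub]) (use X in auto)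
  moreover have "\<dots> \<le> card X" by (rule card_mono) (use X in auto)
  ultimately have aL: "(2::nat) ^ a \<le> 2 ^ L" and br: "branching X (map ((^) 2) (a # as)) E"
    using a(1) L by (linarith, simp add: W_def)
  from aL have "a \<le> L" by simp
  have "card E \<le> (L + 1) ^ t * (2 ^ (a + 1) * P as * c)"
    using as(2) a(2) unfolding cA
    by (meson less_imp_le mult_le_mono order_refl order_trans)
  also have "\<dots> \<le> (L + 1) ^ T * (2 ^ (a + 1) * P as * c)"
    using Suc.prems(1) by (intro mult_le_mono power_increasing) auto
  also have "\<dots> = (\<Prod>a\<leftarrow>a # as. 2 ^ a) * (2 * (L + 1) ^ T) ^ Suc t"
    by (simp add: P_def c_def mult_ac)
  finally show ?case using br as(1) \<open>a \<le> L\<close>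
    by (intro exI[of _ "a # as"]) (auto simp: A_def)
qed

text \<open>Induction on the depth for a whole family of trees, since one set per level must serve
  every \<open>u\<close> and every node reached there. The family grows by at most a factor
  \<open>card X\<close> per level, so \<open>B\<close> bounds the number of sets to be hit on each
  level and enters only through \<open>ln B\<close>.\<close>

lemma branching_cover:
  fixes X :: "'a set" and f :: "'a \<Rightarrow> 'a \<Rightarrow> 'a" and B :: real
  assumes X: "finite X" and f: "\<And>u x. u \<in> X \<Longrightarrow> x \<in> X \<Longrightarrow> f u x \<in> X"
    and inj: "\<And>u. u \<in> X \<Longrightarrow> inj_on (f u) X" and B: "1 \<le> B"
  shows "finite \<E> \<Longrightarrow> (\<And>E. E \<in> \<E> \<Longrightarrow> branching X ks E) \<Longrightarrow> (\<And>k. k \<in> set ks \<Longrightarrow> 0 < k) \<Longrightarrow>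
    real (card \<E>) * real (card X) ^ length ks \<le> B \<Longrightarrow>
    \<exists>Ds. length Ds = length ks \<and> (\<forall>D\<in>set Ds. D \<subseteq> X) \<and>
      (\<Prod>D\<leftarrow>Ds. real (card D)) \<le> (\<Prod>k\<leftarrow>ks. real (card X) / real k * (ln B + 1)) \<and>
      (\<forall>E\<in>\<E>. \<forall>us. set us \<subseteq> X \<and> length us = length ks \<longrightarrow>
        (\<exists>es\<in>E. length es = length ks \<and> (\<forall>j<length ks. f (us ! j) (es ! j) \<in> Ds ! j)))"
proof (induction ks arbitrary: \<E>)
  case Nil
  then show ?case by (intro exI[of _ "[]"]) auto
next
  case (Cons k ks)
  define S where "S E = {x \<in> X. branching X ks {xs. x # xs \<in> E}}" for E
  \<comment> \<open>One set per word and tree: the values \<open>f u x\<close> over the admissible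
    children \<open>x\<close> of the root. Injectivity of \<open>f u\<close> keeps at least
    \<open>k\<close> of them.\<close>
  define F where "F = (\<lambda>(u, E). f u ` S E) ` (X \<times> \<E>)"
  \<comment> \<open>The family for the next level: the subtrees below admissible children.\<close>
  define \<E>' where "\<E>' = (\<lambda>(x, E). {xs. x # xs \<in> E}) ` Sigma X (\<lambda>x. {E \<in> \<E>. x \<in> S E})"
  have fin: "finite F" "finite \<E>'" unfolding F_def \<E>'_def using X Cons.prems(1) by auto
  have "card F \<le> card (X \<times> \<E>)" unfolding F_def using X Cons.prems(1) by (intro card_image_le) auto
  then have "real (card F) \<le> real (card \<E>) * real (card X)"
    by (metis card_cartesian_product mult.commute of_nat_le_iff of_nat_mult)
  have "card \<E>' \<le> card (Sigma X (\<lambda>x. {E \<in> \<E>. x \<in> S E}))"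
    unfolding \<E>'_def using X Cons.prems(1) by (intro card_image_le) auto
  also have "\<dots> \<le> card (X \<times> \<E>)" using X Cons.prems(1) by (intro card_mono) auto
  finally have cE': "real (card \<E>') \<le> real (card \<E>) * real (card X)"
    by (metis card_cartesian_product mult.commute of_nat_le_iff of_nat_mult)
  have "real (card \<E>') * real (card X) ^ length ks \<le> real (card \<E>) * real (card X) * real (card X) ^ length ks"
    using cE' by (intro mult_right_mono) auto
  also have "\<dots> \<le> B" using Cons.prems(4) by (simp add: mult_ac)
  finally have B': "real (card \<E>') * real (card X) ^ length ks \<le> B" .
  have cF: "real (card F) \<le> B"
  proof (cases "card X = 0")
    case True
    then show ?thesis using \<open>real (card F) \<le> _\<close> B by simp
  next
    case False
    then have "real (card \<E>) * real (card X) * 1 \<le> real (card \<E>) * real (card X) * real (card X) ^ length ks"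
      by (intro mult_left_mono one_le_power) auto
    then show ?thesis using \<open>real (card F) \<le> _\<close> Cons.prems(4) by (simp add: mult_ac)
  qed
  have "\<exists>D\<subseteq>X. (\<forall>S\<in>F. S \<inter> D \<noteq> {}) \<and> real (card D) \<le> real (card X) / real k * (ln B + 1)"
  proof (rule hitting_set[OF X fin(1) _ _ cF B])
    show "0 < k" using Cons.prems(3) by simp
  next
    fix T assume "T \<in> F"
    then obtain u E where uE: "u \<in> X" "E \<in> \<E>" "T = f u ` S E" by (auto simp: F_def)
    have SX: "S E \<subseteq> X" by (auto simp: S_def)
    have "card T = card (S E)" unfolding uE(3)
      using inj[OF uE(1)] SX by (intro card_image) (rule inj_on_subset)
    also have "\<dots> \<ge> k" using Cons.prems(2)[OF uE(2)] by (simp add: S_def)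
    finally show "T \<subseteq> X \<and> k \<le> card T" using uE f SX by auto
  qed
  then obtain D where D: "D \<subseteq> X" "\<And>S. S \<in> F \<Longrightarrow> S \<inter> D \<noteq> {}"
    "real (card D) \<le> real (card X) / real k * (ln B + 1)" by blast
  have "\<And>E. E \<in> \<E>' \<Longrightarrow> branching X ks E" by (auto simp: \<E>'_def S_def)
  from Cons.IH[OF fin(2) this _ B'] Cons.prems(3) obtain Ds where
    Ds: "length Ds = length ks" "\<forall>D\<in>set Ds. D \<subseteq> X"
      "(\<Prod>D\<leftarrow>Ds. real (card D)) \<le> (\<Prod>k\<leftarrow>ks. real (card X) / real k * (ln B + 1))"
      "\<And>E us. E \<in> \<E>' \<Longrightarrow> set us \<subseteq> X \<Longrightarrow> length us = length ks \<Longrightarrow>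
        \<exists>es\<in>E. length es = length ks \<and> (\<forall>j<length ks. f (us ! j) (es ! j) \<in> Ds ! j)"
    by (metis list.set_intros(2))
  have "\<exists>es\<in>E. length es = length (k # ks) \<and> (\<forall>j<length (k # ks). f (us ! j) (es ! j) \<in> (D # Ds) ! j)"
    if E: "E \<in> \<E>" and us: "set us \<subseteq> X" "length us = length (k # ks)" for E us
  proof -
    obtain u vs where uvs: "us = u # vs" "u \<in> X" "set vs \<subseteq> X" "length vs = length ks"
      using us by (cases us) auto
    have "f u ` S E \<in> F" using uvs E by (auto simp: F_def)
    then obtain x where x: "x \<in> S E" "f u x \<in> D" using D(2) by blast
    then have "{xs. x # xs \<in> E} \<in> \<E>'" using E by (auto simp: \<E>'_def S_def)
    from Ds(4)[OF this uvs(3,4)] obtain es where es: "x # es \<in> E" "length es = length ks"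
      "\<forall>j<length ks. f (vs ! j) (es ! j) \<in> Ds ! j" by blast
    show ?thesis
      by (rule bexI[OF _ es(1)]) (use es x uvs in \<open>auto simp: nth_Cons split: nat.splits\<close>)
  qed
  moreover have "real (card D) * (\<Prod>D\<leftarrow>Ds. real (card D)) \<le>
      (real (card X) / real k * (ln B + 1)) * (\<Prod>k\<leftarrow>ks. real (card X) / real k * (ln B + 1))"
    using D(3) Ds(3) B by (intro mult_mono) (auto intro!: prod_list_nonneg)
  ultimately show ?case using D(1) Ds(1,2)
    by (intro exI[of _ "D # Ds"]) auto
qed

subsection \<open>Entropy estimates\<close>

lemma entropy_fun_ln:
  assumes "Q \<ge> 2"
  shows "entropy_fun Q x * ln (real Q) = x * ln (real Q - 1) - x * ln x - (1 - x) * ln (1 - x)"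
proof -
  have "ln (real Q) > 0" using assms by simp
  then show ?thesis by (simp add: entropy_fun_def log_def field_simps)
qed

text \<open>Chernoff bound: each word of the ball has weight at least \<open>z powr (\<rho> * n)\<close> in the generating
  function \<open>(1 + (Q - 1) * z) ^ n\<close>; the optimal \<open>z\<close> is at most 1 since \<open>\<rho> \<le> 1 - 1 / Q\<close>.\<close>

lemma card_hamming_ball_le:
  fixes Y :: "'c set"
  assumes Y: "finite Y" "card Y = Q" and Q: "Q \<ge> 2" and g: "g \<in> {..<n} \<rightarrow>\<^sub>E Y"
    and \<rho>: "0 \<le> \<rho>" "\<rho> < 1 - 1 / real Q"
  shows "real (card {f \<in> {..<n} \<rightarrow>\<^sub>E Y. real (card {k \<in> {..<n}. f k \<noteq> g k}) \<le> \<rho> * real n})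
    \<le> real Q powr (real n * entropy_fun Q \<rho>)"
proof (cases "\<rho> = 0")
  \<comment> \<open>The ball is at most its centre; the general argument needs
    \<open>z > 0\<close>.\<close>
  case True
  have "{f \<in> {..<n} \<rightarrow>\<^sub>E Y. real (card {k \<in> {..<n}. f k \<noteq> g k}) \<le> \<rho> * real n} \<subseteq> {g}"
    using True g by (auto intro: PiE_ext)
  then have "card {f \<in> {..<n} \<rightarrow>\<^sub>E Y. real (card {k \<in> {..<n}. f k \<noteq> g k}) \<le> \<rho> * real n} \<le> card {g}"
    by (intro card_mono) auto
  then show ?thesis using True Q by (simp add: entropy_fun_def)
next
  case False
  \<comment> \<open>The minimiser of \<open>(1 + (Q - 1) * z) ^ n / z powr (\<rho> * n)\<close>; it
    turns \<open>1 + (Q - 1) * z\<close> into \<open>1 / (1 - \<rho>)\<close>.\<close>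
  define z where "z = \<rho> / ((1 - \<rho>) * (real Q - 1))"
  define ball where "ball = {f \<in> {..<n} \<rightarrow>\<^sub>E Y. real (card {k \<in> {..<n}. f k \<noteq> g k}) \<le> \<rho> * real n}"
  have "1 / real Q > 0" using Q by simp
  then have \<rho>01: "0 < \<rho>" "\<rho> < 1" using \<rho> False by linarith+
  have "\<rho> * real Q < real Q - 1" using \<rho>(2) Q by (simp add: field_simps)
  then have "\<rho> \<le> (1 - \<rho>) * (real Q - 1)" by (simp add: algebra_simps)
  then have z: "0 < z" "z \<le> 1" using \<rho>01 Q by (auto simp: z_def)
  \<comment> \<open>Product form of \<open>z\<close> to the power of the Hamming distance from
    \<open>g\<close>, so that the sum over all words factors over the coordinates.\<close>
  define W where "W f = (\<Prod>k\<in>{..<n}. if f k = g k then 1 else z)" for f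
  have W: "W f = z ^ card {k \<in> {..<n}. f k \<noteq> g k}" for f
    unfolding W_def by (subst prod.If_cases) (auto simp: Collect_neg_eq Int_def intro!: arg_cong[where f=card])
  have fin: "finite ({..<n} \<rightarrow>\<^sub>E Y)" using Y by (intro finite_PiE) auto
  have "(\<Sum>f\<in>{..<n} \<rightarrow>\<^sub>E Y. W f) = (\<Prod>k\<in>{..<n}. \<Sum>y\<in>Y. if y = g k then 1 else z)"
    unfolding W_def by (rule prod_sum_PiE[symmetric]) (use Y in auto)
  also have "\<dots> = (\<Prod>k\<in>{..<n}. 1 + (real Q - 1) * z)"
  proof (rule prod.cong[OF refl])
    fix k assume "k \<in> {..<n}"
    then have gk: "g k \<in> Y" using g by auto
    have "(\<Sum>y\<in>Y. if y = g k then 1 else z) = 1 + (\<Sum>y\<in>Y - {g k}. if y = g k then 1 else z)"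
      using gk Y by (simp add: sum.remove)
    also have "(\<Sum>y\<in>Y - {g k}. if y = g k then 1 else z) = (\<Sum>y\<in>Y - {g k}. z)"
      by (rule sum.cong) auto
    also have "\<dots> = (real Q - 1) * z" using gk Y Q by (simp add: of_nat_diff)
    finally show "(\<Sum>y\<in>Y. if y = g k then 1 else z) = 1 + (real Q - 1) * z" .
  qed
  also have "\<dots> = (1 + (real Q - 1) * z) ^ n" by simp
  also have "(real Q - 1) * z = \<rho> / (1 - \<rho>)" using Q by (simp add: z_def)
  also have "1 + \<rho> / (1 - \<rho>) = 1 / (1 - \<rho>)" using \<rho>01 by (simp add: field_simps)
  finally have tot: "(\<Sum>f\<in>{..<n} \<rightarrow>\<^sub>E Y. W f) = (1 / (1 - \<rho>)) ^ n" .
  have "real (card ball) * z powr (\<rho> * real n) = (\<Sum>f\<in>ball. z powr (\<rho> * real n))" by simp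
  also have "\<dots> \<le> (\<Sum>f\<in>ball. W f)"
  proof (rule sum_mono)
    fix f assume "f \<in> ball"
    then have "real (card {k \<in> {..<n}. f k \<noteq> g k}) \<le> \<rho> * real n" by (simp add: ball_def)
    then have "z powr (\<rho> * real n) \<le> z powr real (card {k \<in> {..<n}. f k \<noteq> g k})"
      using z by (intro powr_mono') auto
    then show "z powr (\<rho> * real n) \<le> W f" using z by (simp add: W powr_realpow)
  qed
  also have "\<dots> \<le> (\<Sum>f\<in>{..<n} \<rightarrow>\<^sub>E Y. W f)"
    using fin z by (intro sum_mono2) (auto simp: ball_def W)
  also have "\<dots> = exp (- real n * ln (1 - \<rho>))"
    unfolding tot using \<rho>01 by (simp add: exp_minus exp_of_nat_mult field_simps power_divide)
  finally have "real (card ball) * exp (\<rho> * real n * ln z) \<le> exp (- real n * ln (1 - \<rho>))"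
    using z by (simp add: powr_def)
  then have "real (card ball) \<le> exp (- real n * ln (1 - \<rho>) - \<rho> * real n * ln z)"
    by (simp add: exp_diff field_simps)
  also have "ln z = ln \<rho> - (ln (1 - \<rho>) + ln (real Q - 1))"
    unfolding z_def using \<rho>01 Q by (simp add: ln_div ln_mult)
  also have "- real n * ln (1 - \<rho>) - \<rho> * real n * (ln \<rho> - (ln (1 - \<rho>) + ln (real Q - 1))) =
      real n * (entropy_fun Q \<rho> * ln (real Q))"
    unfolding entropy_fun_ln[OF Q] by (simp add: algebra_simps)
  finally show ?thesis using Q by (simp add: ball_def powr_def mult_ac)
qed

section \<open>Stirling bounds and sphere sizes\<close>

text \<open>Lower half of Stirling's estimate; the induction step is
  \<open>(1 + 1 / n) ^ n \<le> exp 1\<close>.\<close>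

lemma power_self_le_fact_exp: "real n ^ n \<le> fact n * exp (real n)"
proof (induction n)
  case (Suc n)
  have "real (Suc n) ^ n \<le> exp 1 * real n ^ n"
  proof (cases "n = 0")
    case False
    have "(1 + 1 / real n) ^ n \<le> exp (1 / real n) ^ n"
      by (intro power_mono) auto
    also have "\<dots> = exp 1" using False by (simp add: exp_of_nat_mult[symmetric])
    finally have "(real (Suc n) / real n) ^ n \<le> exp 1" using False by (simp add: field_simps)
    then show ?thesis using False by (simp add: power_divide field_simps)
  qed simp
  also have "\<dots> \<le> exp 1 * (fact n * exp (real n))" using Suc.IH by simp
  finally have "real (Suc n) * real (Suc n) ^ n \<le> real (Suc n) * (exp 1 * (fact n * exp (real n)))"
    by (intro mult_left_mono) auto
  then show ?case by (simp add: exp_add mult_ac)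
qed simp

text \<open>Upper half of Stirling's estimate, up to a linear factor; the induction step is
  \<open>(1 - 1 / (n + 1)) ^ (n + 1) \<le> exp (- 1)\<close>.\<close>

lemma fact_exp_le: "fact n * exp (real n) \<le> exp 1 * real (n + 1) * real n ^ n"
proof -
  \<comment> \<open>This form fails at 0; the factor \<open>n + 1\<close> and
    \<open>0 ^ 0 = 1\<close> make the final bound hold there too.\<close>
  have "fact n * exp (real n) \<le> exp 1 * real n ^ (n + 1)" if "n \<ge> 1"
    using that
  proof (induction n rule: nat_induct_at_least)
    case (Suc n)
    have "(1 - 1 / real (Suc n)) ^ Suc n \<le> exp (- (1 / real (Suc n))) ^ Suc n"
      using exp_ge_add_one_self[of "- (1 / real (Suc n))"] by (intro power_mono) auto
    also have "\<dots> = exp (- 1)" by (simp add: exp_of_nat_mult[symmetric] del: of_nat_Suc power_Suc)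
    also have "1 - 1 / real (Suc n) = real n / real (Suc n)" by (simp add: field_simps)
    finally have "exp 1 * real n ^ Suc n \<le> real (Suc n) ^ Suc n"
      by (simp add: power_divide exp_minus field_simps del: power_Suc of_nat_Suc)
    then have "exp 1 * (real (Suc n) * (exp 1 * real n ^ Suc n)) \<le> exp 1 * (real (Suc n) * real (Suc n) ^ Suc n)"
      by (intro mult_left_mono) auto
    moreover have "fact (Suc n) * exp (real (Suc n)) \<le> exp 1 * (real (Suc n) * (exp 1 * real n ^ Suc n))"
    proof -
      have "(real (Suc n) * exp 1) * (fact n * exp (real n)) \<le> (real (Suc n) * exp 1) * (exp 1 * real n ^ Suc n)"
        using Suc.IH by (intro mult_left_mono) auto
      then show ?thesis by (simp add: exp_add mult_ac del: power_Suc)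
    qed
    ultimately have "fact (Suc n) * exp (real (Suc n)) \<le> exp 1 * (real (Suc n) * real (Suc n) ^ Suc n)"
      by (rule order_trans[rotated])
    then show ?case by (simp only: power_Suc Suc_eq_plus1[symmetric])
  qed simp
  moreover have "exp 1 * real n ^ (n + 1) \<le> exp 1 * real (n + 1) * real n ^ n"
    by (simp add: mult_right_mono)
  ultimately show ?thesis by (cases "n = 0") (auto intro: order_trans)
qed

text \<open>Stirling from below for \<open>fact m\<close> and from above for \<open>fact w\<close>
  and \<open>fact (m - w)\<close>; the exponentials cancel. With \<open>0 ^ 0 = 1\<close> the ends
  \<open>w = 0\<close> and \<open>w = m\<close> are included.\<close>

lemma binomial_lower_bound:
  assumes "w \<le> m"
  shows "real m ^ m \<le> real (m choose w) * (real w ^ w * real (m - w) ^ (m - w)) * (exp 1 * real (m + 1))\<^sup>2"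
proof -
  have "real m ^ m \<le> fact m * exp (real m)" by (rule power_self_le_fact_exp)
  also have "fact m = fact w * fact (m - w) * real (m choose w)"
    using binomial_fact_lemma[OF assms] by (metis of_nat_fact of_nat_mult)
  also have "exp (real m) = exp (real w) * exp (real (m - w))"
    using assms by (simp add: exp_add[symmetric] of_nat_diff)
  also have "fact w * fact (m - w) * real (m choose w) * (exp (real w) * exp (real (m - w))) =
      real (m choose w) * ((fact w * exp (real w)) * (fact (m - w) * exp (real (m - w))))"
    by (simp add: mult_ac)
  also have "\<dots> \<le> real (m choose w) *
      ((exp 1 * real (w + 1) * real w ^ w) * (exp 1 * real (m - w + 1) * real (m - w) ^ (m - w)))"
    by (intro mult_left_mono mult_mono fact_exp_le) auto
  also have "\<dots> \<le> real (m choose w) *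
      ((exp 1 * real (m + 1) * real w ^ w) * (exp 1 * real (m + 1) * real (m - w) ^ (m - w)))"
    using assms by (intro mult_left_mono mult_mono mult_right_mono) auto
  also have "\<dots> = real (m choose w) * (real w ^ w * real (m - w) ^ (m - w)) * (exp 1 * real (m + 1))\<^sup>2"
    by (simp add: power2_eq_square mult_ac)
  finally show ?thesis .
qed

text \<open>Logarithm of the binomial bound: a Hamming sphere of radius \<open>w\<close> over
  \<open>Q\<close> letters attains the entropy exponent up to a polynomial factor.\<close>

lemma ln_sphere_size_ge:
  assumes "w < m" "Q \<ge> 2"
  shows "real m * entropy_fun Q (real w / real m) * ln (real Q) - 2 - 2 * ln (real (m + 1))
    \<le> ln (real (m choose w) * (real Q - 1) ^ w)"
proof -
  have ch: "real (m choose w) > 0" using assms by simp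
  have ln_pow: "ln (real k ^ k) = real k * ln (real k)" for k
    by (cases "k = 0") (auto simp: ln_realpow)
  have pow: "real k ^ k > 0" for k :: nat by (cases "k = 0") auto
  have mw: "1 - real w / real m = real (m - w) / real m" "real (m - w) > 0" "real m > 0"
    using assms by (auto simp: field_simps of_nat_diff)
  have "ln (real m ^ m) \<le>
      ln (real (m choose w) * (real w ^ w * real (m - w) ^ (m - w)) * (exp 1 * real (m + 1))\<^sup>2)"
    using pow[of m] binomial_lower_bound[of w m] assms by (intro ln_mono) auto
  also have "\<dots> = ln (real (m choose w)) + (ln (real w ^ w) + ln (real (m - w) ^ (m - w))) +
      2 * (1 + ln (real (m + 1)))"
    using ch pow[of w] pow[of "m - w"] by (simp add: ln_mult ln_realpow del: of_nat_add of_nat_Suc)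
  finally have "real m * ln (real m) \<le> ln (real (m choose w)) +
      (real w * ln (real w) + real (m - w) * ln (real (m - w))) + 2 + 2 * ln (real (m + 1))"
    unfolding ln_pow by simp
  moreover have "ln (real (m choose w) * (real Q - 1) ^ w) = ln (real (m choose w)) + real w * ln (real Q - 1)"
    using ch assms by (simp add: ln_mult ln_realpow)
  moreover have "real m * entropy_fun Q (real w / real m) * ln (real Q) =
      real w * ln (real Q - 1) + real m * ln (real m) - real w * ln (real w) - real (m - w) * ln (real (m - w))"
  \<comment> \<open>Splitting \<open>ln (w / m)\<close> into a difference needs
    \<open>w > 0\<close>.\<close>
  proof (cases "w = 0")
    case True
    then show ?thesis by (simp add: entropy_fun_def)
  next
    case False
    have e: "real m * entropy_fun Q (real w / real m) * ln (real Q) =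
      real m * (real w / real m * ln (real Q - 1) - real w / real m * ln (real w / real m)
        - real (m - w) / real m * ln (real (m - w) / real m))"
      using entropy_fun_ln[OF assms(2), of "real w / real m"] by (simp add: mult.assoc mw(1))
    have "\<dots> = real w * ln (real Q - 1) - real w * ln (real w / real m) - real (m - w) * ln (real (m - w) / real m)"
      using mw(3) by (simp add: right_diff_distrib)
    also have "\<dots> = real w * ln (real Q - 1) + (real w + real (m - w)) * ln (real m)
        - real w * ln (real w) - real (m - w) * ln (real (m - w))"
      using False mw by (simp add: ln_div algebra_simps)
    also have "real w + real (m - w) = real m" using assms by simp
    finally show ?thesis using e by simp
  qed
  ultimately show ?thesis by linarith
qed

lemma isCont_entropy_fun:
  assumes "Q \<ge> 2" "0 < x" "x < 1"
  shows "isCont (entropy_fun Q) x"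
  unfolding entropy_fun_def log_def using assms by (intro continuous_intros) auto

lemma floor_mult_div_tendsto: "(\<lambda>m. real_of_int \<lfloor>x * real m\<rfloor> / real m) \<longlonglongrightarrow> x"
  by real_asymp

subsection \<open>Sphere covering and the repetition code\<close>

lemma real_Max_le_iff:
  fixes A :: "nat set"
  assumes "finite A" "A \<noteq> {}"
  shows "real (Max A) \<le> r \<longleftrightarrow> (\<forall>a\<in>A. real a \<le> r)"
  using assms by (meson Max_ge Max_in of_nat_mono order_trans)

lemma real_Min_le_iff:
  fixes A :: "nat set"
  assumes "finite A" "A \<noteq> {}"
  shows "real (Min A) \<le> r \<longleftrightarrow> (\<exists>a\<in>A. real a \<le> r)"
  using assms by (meson Min_le Min_in of_nat_mono order_trans)

locale covering_alphabet = group G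
  for G :: "('a, 'b) monoid_scheme" (structure) +
  fixes q t :: nat
  assumes card_G: "card (carrier G) = q" and q2: "q \<ge> 2" and t1: "t \<ge> 1"
begin

section \<open>Codes, distances and the covering radius\<close>

lemma finite_carrier: "finite (carrier G)"
  using card_G q2 by (simp add: card_ge_0_finite)

lemma finite_code_words: "finite (code_words G n)"
  unfolding code_words_def using finite_carrier by (intro finite_PiE) auto

lemma finite_code_matrices: "finite (code_matrices G t n)"
  unfolding code_matrices_def using finite_code_words by (intro finite_PiE) auto

lemma card_code_words: "card (code_words G n) = q ^ n"
  unfolding code_words_def using card_G by (simp add: card_PiE)

lemma card_code_matrices: "card (code_matrices G t n) = (q ^ t) ^ n"
  unfolding code_matrices_def by (simp add: card_PiE card_code_words power_mult[symmetric] mult.commute)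

lemma code_matrices_nonempty: "code_matrices G t n \<noteq> {}"
  using card_code_matrices[of n] q2 by fastforce

lemma code_matrices_entry:
  "v \<in> code_matrices G t n \<Longrightarrow> i < t \<Longrightarrow> j < n \<Longrightarrow> v i j \<in> carrier G"
  unfolding code_matrices_def code_words_def by (auto simp: PiE_iff)

lemma t_distance_eq:
  assumes "v \<in> code_matrices G t n" "u \<in> code_matrices G t n"
  shows "t_distance G t n v u = card {j \<in> {..<n}. \<exists>i<t. v i j \<noteq> u i j}"
proof -
  have "v i j \<otimes> inv (u i j) = \<one> \<longleftrightarrow> v i j = u i j" if "i < t" "j < n" for i j
    using inv_solve_right'[of "\<one>" "v i j" "u i j"] assms that
    by (simp add: code_matrices_entry)
  then show ?thesis
    unfolding t_distance_def t_weight_def matrix_diff_def by (intro arg_cong[where f = card]) auto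
qed

lemma code_power_eq:
  assumes "C \<subseteq> code_words G n"
  shows "code_power G t n C = {..<t} \<rightarrow>\<^sub>E C"
  using assms unfolding code_power_def code_matrices_def by (auto simp: PiE_iff extensional_def)

text \<open>Both extrema range over finite nonempty sets and so unfold into quantifiers, the only
  form in which the radius is used below.\<close>

lemma covering_radius_le_iff:
  assumes C: "C \<noteq> {}" "C \<subseteq> code_words G n"
  shows "real (covering_radius G t n C) \<le> r \<longleftrightarrow>
    (\<forall>u\<in>code_matrices G t n. \<exists>c\<in>code_power G t n C. real (t_distance G t n c u) \<le> r)"
proof -
  have "finite (code_power G t n C)" "code_power G t n C \<noteq> {}"
    using C finite_subset[OF C(2) finite_code_words]
    by (auto simp: code_power_eq[OF C(2)] PiE_eq_empty_iff intro!: finite_PiE)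
  then show ?thesis
    unfolding covering_radius_def using finite_code_matrices code_matrices_nonempty
    by (subst real_Max_le_iff) (auto simp: real_Min_le_iff)
qed

abbreviation covering_codes :: "nat \<Rightarrow> real \<Rightarrow> (nat \<Rightarrow> 'a) set set" where
  "covering_codes n r \<equiv>
    {C. C \<noteq> {} \<and> C \<subseteq> code_words G n \<and> real (covering_radius G t n C) \<le> r}"

lemma finite_covering_codes: "finite (covering_codes n r)"
  by (rule finite_subset[of _ "Pow (code_words G n)"]) (use finite_code_words in auto)

text \<open>The whole space has covering radius 0, so the \<open>Min\<close> in
  \<open>min_log_size\<close> is over a nonempty set.\<close>

lemma covering_codes_nonempty:
  assumes "0 \<le> r"
  shows "code_words G n \<in> covering_codes n r"
proof -
  have ne: "code_words G n \<noteq> {}" using card_code_words[of n] q2 by fastforce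
  have "t_distance G t n u u = 0" if "u \<in> code_matrices G t n" for u
    using that by (simp add: t_distance_eq)
  moreover have "u \<in> code_power G t n (code_words G n)" if "u \<in> code_matrices G t n" for u
    using that by (simp add: code_power_eq code_matrices_def)
  ultimately have "\<forall>u\<in>code_matrices G t n. \<exists>c\<in>code_power G t n (code_words G n). real (t_distance G t n c u) \<le> r"
    using assms by (metis of_nat_0)
  then show ?thesis using ne by (simp add: covering_radius_le_iff)
qed

lemma min_log_size_image:
  "min_log_size G t n r = Min ((\<lambda>C. log (real q) (real (card C))) ` covering_codes n r)"
  unfolding min_log_size_def card_G by (rule arg_cong[where f = Min]) auto

lemma min_log_size_le:
  assumes "C \<in> covering_codes n r"
  shows "min_log_size G t n r \<le> log (real q) (real (card C))"
  unfolding min_log_size_image using assms finite_covering_codes by (intro Min_le) auto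

lemma min_log_size_ge:
  assumes "0 \<le> r" "\<And>C. C \<in> covering_codes n r \<Longrightarrow> b \<le> log (real q) (real (card C))"
  shows "b \<le> min_log_size G t n r"
  unfolding min_log_size_image using assms finite_covering_codes covering_codes_nonempty[OF assms(1)]
  by (subst Min_ge_iff) auto

section \<open>Matrices as words over an alphabet of size \<open>q ^ t\<close>\<close>

definition column_words :: "(nat \<Rightarrow> 'a) set" where
  "column_words = {..<t} \<rightarrow>\<^sub>E carrier G"

lemma finite_column_words: "finite column_words"
  unfolding column_words_def using finite_carrier by (intro finite_PiE) auto

lemma card_column_words: "card column_words = q ^ t"
  unfolding column_words_def using card_G by (simp add: card_PiE)

lemma column_words_nonempty: "column_words \<noteq> {}"
  unfolding column_words_def by (auto simp: PiE_eq_empty_iff)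

lemma q_pow_t_ge: "q ^ t \<ge> 2"
  using q2 t1 by (metis One_nat_def Suc_1 Suc_le_eq le_trans less_le_trans power_increasing power_one_right zero_less_numeral le_numeral_extra(4) one_le_numeral)

text \<open>Transposing turns the t-distance into the Hamming distance over \<open>q ^ t\<close>
  letters, to which the ball estimate applies.\<close>

definition columns :: "nat \<Rightarrow> (nat \<Rightarrow> nat \<Rightarrow> 'a) \<Rightarrow> nat \<Rightarrow> nat \<Rightarrow> 'a" where
  "columns n v = (\<lambda>j\<in>{..<n}. \<lambda>i\<in>{..<t}. v i j)"

lemma columns_in: "v \<in> code_matrices G t n \<Longrightarrow> columns n v \<in> {..<n} \<rightarrow>\<^sub>E column_words"
  unfolding columns_def column_words_def by (auto simp: code_matrices_entry)

lemma columns_neq_iff: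
  "j < n \<Longrightarrow> columns n v j \<noteq> columns n u j \<longleftrightarrow> (\<exists>i<t. v i j \<noteq> u i j)"
  unfolding columns_def by (auto simp: restrict_def fun_eq_iff)

lemma inj_on_columns: "inj_on (columns n) (code_matrices G t n)"
proof (rule inj_onI)
  fix u v assume u: "u \<in> code_matrices G t n" and v: "v \<in> code_matrices G t n"
    and eq: "columns n u = columns n v"
  have "u i j = v i j" if "i < t" "j < n" for i j
    using columns_neq_iff[OF that(2), of u v] eq that(1) by auto
  then have "u i = v i" if "i < t" for i
    using u v that unfolding code_matrices_def code_words_def
    by (intro PiE_ext[of "u i" "{..<n}" "\<lambda>_. carrier G"]) (auto simp: PiE_iff)
  then show "u = v" using u v unfolding code_matrices_def by (intro PiE_ext) auto
qed

lemma sphere_covering_bound: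
  assumes C: "C \<in> covering_codes n (\<rho> * real n)"
    and \<rho>: "0 \<le> \<rho>" "\<rho> < 1 - 1 / real q ^ t"
  shows "real n * (1 - entropy_fun (q ^ t) \<rho>) \<le> log (real q) (real (card C))"
proof -
  define Q where "Q = q ^ t"
  define V where "V = real Q powr (real n * entropy_fun Q \<rho>)"
  define S where "S c = {u \<in> code_matrices G t n. real (t_distance G t n c u) \<le> \<rho> * real n}" for c
  have Q: "Q \<ge> 2" using q_pow_t_ge by (simp add: Q_def)
  have CC: "C \<noteq> {}" "C \<subseteq> code_words G n" using C by auto
  have fC: "finite C" using CC finite_code_words finite_subset by blast
  have card_pow: "card (code_power G t n C) = card C ^ t"
    using CC by (simp add: code_power_eq card_PiE)
  have fP: "finite (code_power G t n C)"
    using CC fC by (simp add: code_power_eq finite_PiE)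
  \<comment> \<open>\<open>columns\<close> embeds each ball into a Hamming ball over
    \<open>Q\<close> letters, which the Chernoff bound limits to \<open>V\<close>.\<close>
  have S: "real (card (S c)) \<le> V" if c: "c \<in> code_power G t n C" for c
  proof -
    have c': "c \<in> code_matrices G t n" using c by (simp add: code_power_def)
    have "columns n ` S c \<subseteq>
      {f \<in> {..<n} \<rightarrow>\<^sub>E column_words. real (card {k \<in> {..<n}. f k \<noteq> columns n c k}) \<le> \<rho> * real n}"
    proof (rule image_subsetI, intro CollectI conjI)
      fix u assume u: "u \<in> S c"
      then have u': "u \<in> code_matrices G t n" by (simp add: S_def)
      then show "columns n u \<in> {..<n} \<rightarrow>\<^sub>E column_words" by (rule columns_in)
      have "{k \<in> {..<n}. columns n u k \<noteq> columns n c k} = {j \<in> {..<n}. \<exists>i<t. c i j \<noteq> u i j}"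
        using columns_neq_iff by fastforce
      then show "real (card {k \<in> {..<n}. columns n u k \<noteq> columns n c k}) \<le> \<rho> * real n"
        using u t_distance_eq[OF c' u'] by (simp add: S_def)
    qed
    moreover have "finite ({..<n} \<rightarrow>\<^sub>E column_words)" using finite_column_words by (intro finite_PiE) auto
    ultimately have "card (columns n ` S c) \<le>
      card {f \<in> {..<n} \<rightarrow>\<^sub>E column_words. real (card {k \<in> {..<n}. f k \<noteq> columns n c k}) \<le> \<rho> * real n}"
      by (intro card_mono) auto
    moreover have "card (columns n ` S c) = card (S c)"
      by (rule card_image) (rule inj_on_subset[OF inj_on_columns], auto simp: S_def)
    moreover have "real (card {f \<in> {..<n} \<rightarrow>\<^sub>E column_words. real (card {k \<in> {..<n}. f k \<noteq> columns n c k}) \<le> \<rho> * real n}) \<le> V"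
      unfolding V_def using \<rho>
      by (intro card_hamming_ball_le finite_column_words Q columns_in c') (auto simp: card_column_words Q_def)
    ultimately show ?thesis by linarith
  qed
  have "code_matrices G t n \<subseteq> (\<Union>c\<in>code_power G t n C. S c)"
    using C CC by (auto simp: covering_radius_le_iff S_def)
  then have "card (code_matrices G t n) \<le> card (\<Union>c\<in>code_power G t n C. S c)"
    by (intro card_mono) (auto simp: fP S_def finite_code_matrices)
  also have "\<dots> \<le> (\<Sum>c\<in>code_power G t n C. card (S c))" by (rule card_UN_le[OF fP])
  finally have "real (card (code_matrices G t n)) \<le> (\<Sum>c\<in>code_power G t n C. real (card (S c)))"
    by (metis of_nat_le_iff of_nat_sum)
  also have "\<dots> \<le> (\<Sum>c\<in>code_power G t n C. V)" by (intro sum_mono S)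
  finally have main: "real Q ^ n \<le> real (card C) ^ t * V"
    by (simp add: card_code_matrices card_pow Q_def)
  have cC: "real (card C) > 0" using CC fC by (simp add: card_gt_0_iff)
  have lnq: "ln (real q) > 0" using q2 by simp
  \<comment> \<open>This \<open>t\<close> cancels the exponent of \<open>card C ^ t\<close>, leaving
    a bound to base \<open>q\<close>.\<close>
  have lnQ: "ln (real Q) = real t * ln (real q)" using q2 by (simp add: Q_def ln_realpow)
  have "ln (real Q ^ n) \<le> ln (real (card C) ^ t * V)"
    using main Q cC by (intro ln_mono) (auto simp: V_def)
  also have "\<dots> = real t * ln (real (card C)) + real n * entropy_fun Q \<rho> * ln (real Q)"
    using cC Q by (simp add: V_def ln_mult ln_realpow ln_powr)
  finally have "real n * (real t * ln (real q)) \<le>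
      real t * ln (real (card C)) + real n * entropy_fun Q \<rho> * (real t * ln (real q))"
    using Q by (simp add: ln_realpow lnQ)
  then have "real t * (real n * (1 - entropy_fun Q \<rho>) * ln (real q)) \<le> real t * ln (real (card C))"
    by (simp add: algebra_simps)
  then have "real n * (1 - entropy_fun Q \<rho>) * ln (real q) \<le> ln (real (card C))"
    using t1 by simp
  then show ?thesis using lnq by (simp add: log_def field_simps Q_def)
qed

text \<open>Pigeonhole: some column \<open>y\<close> occurs at least \<open>n / q ^ t\<close> times
  in \<open>u\<close>, and the matrix with all columns equal to \<open>y\<close> has constant
  rows.\<close>

lemma repetition_code:
  assumes "1 - 1 / real q ^ t \<le> \<rho>"
  shows "\<exists>C \<in> covering_codes n (\<rho> * real n). card C \<le> q"
proof -
  define C where "C = (\<lambda>a. \<lambda>j\<in>{..<n}. a) ` carrier G"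
  have CC: "C \<noteq> {}" "C \<subseteq> code_words G n"
  proof -
    show "C \<noteq> {}" unfolding C_def using one_closed by blast
    show "C \<subseteq> code_words G n"
      unfolding C_def code_words_def by (rule image_subsetI, subst restrict_PiE_iff) simp
  qed
  have card_C: "card C \<le> q" unfolding C_def card_G[symmetric] by (rule card_image_le[OF finite_carrier])
  have cov: "\<exists>c\<in>code_power G t n C. real (t_distance G t n c u) \<le> \<rho> * real n"
    if u: "u \<in> code_matrices G t n" for u
  proof -
    define A where "A y = {j \<in> {..<n}. columns n u j = y}" for y
    have "(\<Sum>y\<in>column_words. card (A y)) = card {..<n}"
    proof -
      have "{..<n} = (\<Union>y\<in>column_words. A y)" using columns_in[OF u] by (auto simp: A_def)
      moreover have "card (\<Union>y\<in>column_words. A y) = (\<Sum>y\<in>column_words. card (A y))"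
        by (rule card_UN_disjoint[OF finite_column_words]) (auto simp: A_def)
      ultimately show ?thesis by metis
    qed
    then have sum: "(\<Sum>y\<in>column_words. real (card (A y))) = real n"
      by (simp flip: of_nat_sum)
    have "\<exists>y\<in>column_words. real n / real q ^ t \<le> real (card (A y))"
    proof (rule ccontr)
      assume "\<not> ?thesis"
      then have "(\<Sum>y\<in>column_words. real (card (A y))) < (\<Sum>y\<in>column_words. real n / real q ^ t)"
        using column_words_nonempty by (intro sum_strict_mono finite_column_words) (auto simp: not_le)
      then show False using sum q2 by (simp add: card_column_words)
    qed
    then obtain y where y: "y \<in> column_words" "real n / real q ^ t \<le> real (card (A y))" by blast
    define c where "c = (\<lambda>i\<in>{..<t}. \<lambda>j\<in>{..<n}. y i)"
    have c: "c \<in> code_power G t n C"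
      unfolding code_power_eq[OF CC(2)] c_def
    proof (rule restrict_PiE_iff[THEN iffD2], rule ballI)
      fix i assume "i \<in> {..<t}"
      then have "y i \<in> carrier G" using y(1) by (auto simp: column_words_def)
      then show "(\<lambda>j\<in>{..<n}. y i) \<in> C" unfolding C_def by (rule imageI)
    qed
    then have c': "c \<in> code_matrices G t n" unfolding code_power_def by blast
    have "{j \<in> {..<n}. \<exists>i<t. c i j \<noteq> u i j} \<subseteq> {..<n} - A y"
      by (auto simp: A_def columns_def c_def)
    then have "t_distance G t n c u \<le> card ({..<n} - A y)"
      unfolding t_distance_eq[OF c' u] by (intro card_mono) auto
    also have "\<dots> = n - card (A y)" by (subst card_Diff_subset) (auto simp: A_def)
    finally have "t_distance G t n c u \<le> n - card (A y)" .
    moreover have "card (A y) \<le> card {..<n}" by (rule card_mono) (auto simp: A_def)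
    ultimately have "real (t_distance G t n c u) \<le> real n - real (card (A y))" by simp
    also have "\<dots> \<le> (1 - 1 / real q ^ t) * real n" using y(2) by (simp add: algebra_simps)
    also have "\<dots> \<le> \<rho> * real n" using assms by (intro mult_right_mono) auto
    finally show ?thesis using c by blast
  qed
  have "C \<in> covering_codes n (\<rho> * real n)"
    using CC cov by (simp only: mem_Collect_eq covering_radius_le_iff[OF CC]) simp
  then show ?thesis using card_C by - (rule bexI)
qed

subsection \<open>Block codes from hitting sets\<close>

text \<open>Kept as lists of rows, so that they are leaves of a tree of depth \<open>t\<close> in
  the sense of \<open>branching\<close>.\<close>

definition light_errors :: "nat \<Rightarrow> nat \<Rightarrow> (nat \<Rightarrow> 'a) list set" where
  "light_errors m w = {es. set es \<subseteq> code_words G m \<and> length es = t \<and>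
     card {k \<in> {..<m}. \<exists>j<t. (es ! j) k \<noteq> \<one>} \<le> w}"

text \<open>Only matrices with exactly \<open>w\<close> nonzero columns are counted: choose the
  support, then a nonzero column at each of its positions.\<close>

lemma card_light_errors_ge: "(m choose w) * (q ^ t - 1) ^ w \<le> card (light_errors m w)"
proof -
  define o' where "o' = (\<lambda>i\<in>{..<t}. \<one>)"
  define \<S> where "\<S> = {S. S \<subseteq> {..<m} \<and> card S = w}"
  \<comment> \<open>The column sequences with support exactly \<open>S\<close>; hence these sets are
    disjoint for different \<open>S\<close>.\<close>
  define P where "P S = (\<Pi>\<^sub>E k\<in>{..<m}. if k \<in> S then column_words - {o'} else {o'})" for S :: "nat set"
  define rows where "rows f = map (\<lambda>j. \<lambda>k\<in>{..<m}. f k j) [0..<t]" for f :: "nat \<Rightarrow> nat \<Rightarrow> 'a"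
  have o': "o' \<in> column_words" by (auto simp: o'_def column_words_def)
  have f\<S>: "finite \<S>" unfolding \<S>_def by (rule finite_subset[of _ "Pow {..<m}"]) auto
  have card_P: "card (P S) = (q ^ t - 1) ^ w" if "S \<in> \<S>" for S
  proof -
    have "card (P S) = (\<Prod>k<m. if k \<in> S then q ^ t - 1 else 1)"
      unfolding P_def using o' finite_column_words
      by (subst card_PiE) (auto intro!: prod.cong simp: card_column_words)
    also have "\<dots> = (q ^ t - 1) ^ card ({..<m} \<inter> S)"
      by (subst prod.If_cases) auto
    also have "{..<m} \<inter> S = S" using that by (auto simp: \<S>_def)
    finally show ?thesis using that by (simp add: \<S>_def)
  qed
  have fP: "finite (P S)" for S
    unfolding P_def using finite_column_words by (intro finite_PiE) auto
  have supp: "{k \<in> {..<m}. f k \<noteq> o'} = S" if "f \<in> P S" "S \<in> \<S>" for f S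
    using that unfolding P_def \<S>_def by (fastforce simp: PiE_iff split: if_splits)
  have cw: "f \<in> {..<m} \<rightarrow>\<^sub>E column_words" if "f \<in> P S" for f S
    using that o' unfolding P_def by (fastforce simp: PiE_iff split: if_splits)
  have "(m choose w) * (q ^ t - 1) ^ w = (\<Sum>S\<in>\<S>. card (P S))"
    using n_subsets[of "{..<m}" w] by (simp add: card_P \<S>_def)
  also have "\<dots> = card (\<Union>S\<in>\<S>. P S)"
    by (rule card_UN_disjoint[symmetric]) (use f\<S> fP supp in blast)+
  also have "\<dots> = card (rows ` (\<Union>S\<in>\<S>. P S))"
  proof (rule card_image[symmetric], rule inj_onI)
    fix f g assume fg: "f \<in> (\<Union>S\<in>\<S>. P S)" "g \<in> (\<Union>S\<in>\<S>. P S)" and eq: "rows f = rows g"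
    have "f k j = g k j" if "k < m" "j < t" for k j
    proof -
      have "(rows f ! j) k = (rows g ! j) k" using eq by simp
      then show ?thesis using that by (simp add: rows_def)
    qed
    moreover have fg': "f \<in> {..<m} \<rightarrow>\<^sub>E column_words" "g \<in> {..<m} \<rightarrow>\<^sub>E column_words" using fg cw by auto
    ultimately have "f k = g k" if "k < m" for k
      using that unfolding column_words_def
      by (intro PiE_ext[of "f k" "{..<t}" "\<lambda>_. carrier G"]) (auto simp: PiE_iff)
    then show "f = g" using fg' by (intro PiE_ext) auto
  qed
  also have "\<dots> \<le> card (light_errors m w)"
  proof (rule card_mono)
    show "finite (light_errors m w)"
      unfolding light_errors_def
      by (rule finite_subset[OF _ finite_lists_length_eq[OF finite_code_words[of m], of t]]) auto
    show "rows ` (\<Union>S\<in>\<S>. P S) \<subseteq> light_errors m w"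
    proof (rule image_subsetI)
      fix f assume "f \<in> (\<Union>S\<in>\<S>. P S)"
      then obtain S where S: "S \<in> \<S>" "f \<in> P S" by blast
      have f: "f k j \<in> carrier G" if "k < m" "j < t" for k j
        using cw[OF S(2)] that by (auto simp: column_words_def PiE_iff)
      have "{k \<in> {..<m}. \<exists>j<t. (rows f ! j) k \<noteq> \<one>} \<subseteq> {k \<in> {..<m}. f k \<noteq> o'}"
        by (auto simp: rows_def o'_def)
      then have "card {k \<in> {..<m}. \<exists>j<t. (rows f ! j) k \<noteq> \<one>} \<le> w"
        using supp[OF S(2,1)] S(1) card_mono[of "{k \<in> {..<m}. f k \<noteq> o'}"] by (auto simp: \<S>_def)
      moreover have "set (rows f) \<subseteq> code_words G m"
      proof -
        have "(\<lambda>k\<in>{..<m}. f k j) \<in> code_words G m" if "j < t" for j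
          unfolding code_words_def restrict_PiE_iff using f that by simp
        then show ?thesis unfolding rows_def by auto
      qed
      ultimately show "rows f \<in> light_errors m w"
        by (simp add: light_errors_def) (simp add: rows_def)
    qed
  qed
  finally show ?thesis .
qed

text \<open>The word length is split into \<open>t\<close> blocks of length \<open>m\<close>. In block \<open>b\<close>, row \<open>(j + b) mod t\<close> takes
  its part from the \<open>j\<close>-th hitting set \<open>Ds ! j\<close>, so every row meets each hitting set exactly once
  and all rows have codes of the same size.\<close>

lemma block_code:
  fixes m w :: nat and Ds :: "(nat \<Rightarrow> 'a) set list"
  defines "f \<equiv> \<lambda>u x. \<lambda>k\<in>{..<m}. u k \<otimes> inv (x k)"
  assumes len: "length Ds = t" and Ds: "\<forall>D\<in>set Ds. D \<subseteq> code_words G m"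
    and cover: "\<And>us. set us \<subseteq> code_words G m \<Longrightarrow> length us = t \<Longrightarrow>
      \<exists>es\<in>light_errors m w. \<forall>j<t. f (us ! j) (es ! j) \<in> Ds ! j"
  shows "\<exists>C\<in>covering_codes (t * m) (real (t * w)). card C \<le> t * (\<Prod>D\<leftarrow>Ds. card D)"
proof -
  define blk where "blk b c = (\<lambda>k\<in>{..<m}. c (b * m + k))" for b and c :: "nat \<Rightarrow> 'a"
  \<comment> \<open>The position \<open>j\<close> with \<open>(j + b) mod t = i\<close>; adding
    \<open>t - b\<close> avoids truncated subtraction.\<close>
  define J where "J i b = (i + (t - b)) mod t" for i b
  define K where "K i = {c \<in> code_words G (t * m). \<forall>b<t. blk b c \<in> Ds ! J i b}" for i
  \<comment> \<open>All rows of a matrix in \<open>C ^ t\<close> draw on one code, so the row codes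
    \<open>K i\<close> are united, at the cost of a factor \<open>t\<close>.\<close>
  define C where "C = (\<Union>i<t. K i)"
  have Jt: "J i b < t" for i b using t1 by (simp add: J_def)
  have J_add: "(J i b + b) mod t = i" if "i < t" "b < t" for i b
  proof -
    have "(J i b + b) mod t = (i + (t - b) + b) mod t" unfolding J_def by (simp add: mod_add_left_eq)
    also have "\<dots> = i" using that by simp
    finally show ?thesis .
  qed
  \<comment> \<open>Modulo \<open>t\<close>, \<open>J i\<close> sends \<open>b\<close> to
    \<open>i - b\<close> and is its own inverse.\<close>
  have J_bij: "bij_betw (J i) {..<t} {..<t}" if "i < t" for i
  proof -
    have J_eq: "J i b = (if b \<le> i then i - b else i + t - b)" if "b < t" for b
    proof (cases "b \<le> i")
      case True
      then have "i + (t - b) = (i - b) + t" using that by simp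
      then have "J i b = (i - b) mod t" by (simp only: J_def mod_add_self2)
      then show ?thesis using True \<open>i < t\<close> by simp
    next
      case False
      then show ?thesis using that by (simp add: J_def)
    qed
    have "J i (J i b) = b" if "b < t" for b
      using that \<open>i < t\<close> J_eq[OF that] J_eq[OF Jt, of i b] by (auto split: if_splits)
    then show ?thesis using Jt by (intro bij_betw_byWitness[where f' = "J i"]) auto
  qed
  have pos: "b * m + k < t * m" if "b < t" "k < m" for b k
  proof -
    have "b * m + k < Suc b * m" using that by simp
    also have "\<dots> \<le> t * m" using that by (intro mult_right_mono) auto
    finally show ?thesis .
  qed
  have fDs: "finite (Ds ! j)" "Ds ! j \<subseteq> code_words G m" if "j < t" for j
    using that Ds len finite_subset[OF _ finite_code_words] by (metis nth_mem)+
  have card_K: "card (K i) \<le> (\<Prod>D\<leftarrow>Ds. card D)" if i: "i < t" for i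
  proof -
    define h where "h c = (\<lambda>b\<in>{..<t}. blk b c)" for c
    have "inj_on h (K i)"
    proof (rule inj_onI)
      fix c d assume cd: "c \<in> K i" "d \<in> K i" and eq: "h c = h d"
      have "c p = d p" if p: "p < t * m" for p
      proof -
        have m0: "m > 0" using p by (cases m) auto
        have "p div m < t" using p m0 by (simp add: less_mult_imp_div_less)
        then have "blk (p div m) c (p mod m) = blk (p div m) d (p mod m)"
          using fun_cong[OF eq, of "p div m"] by (simp add: h_def)
        then show ?thesis using m0 by (simp add: blk_def)
      qed
      moreover have "c \<in> {..<t * m} \<rightarrow>\<^sub>E carrier G" "d \<in> {..<t * m} \<rightarrow>\<^sub>E carrier G"
        using cd by (simp_all add: K_def code_words_def)
      ultimately show "c = d" by (metis PiE_ext lessThan_iff)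
    qed
    moreover have "h ` K i \<subseteq> (\<Pi>\<^sub>E b\<in>{..<t}. Ds ! J i b)" by (auto simp: h_def K_def)
    moreover have "finite (\<Pi>\<^sub>E b\<in>{..<t}. Ds ! J i b)" using fDs Jt by (intro finite_PiE) auto
    ultimately have "card (K i) \<le> card (\<Pi>\<^sub>E b\<in>{..<t}. Ds ! J i b)" by (metis card_inj_on_le)
    also have "\<dots> = (\<Prod>b<t. card (Ds ! J i b))" by (simp add: card_PiE)
    also have "\<dots> = (\<Prod>j<t. card (Ds ! j))"
      by (rule prod.reindex_bij_betw[OF J_bij[OF i]])
    also have "\<dots> = (\<Prod>D\<leftarrow>Ds. card D)"
      using len by (simp add: prod.list_conv_set_nth atLeast0LessThan)
    finally show ?thesis .
  qed
  have "card C \<le> (\<Sum>i<t. card (K i))" unfolding C_def by (rule card_UN_le) simp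
  also have "\<dots> \<le> (\<Sum>i<t. (\<Prod>D\<leftarrow>Ds. card D))" using card_K by (intro sum_mono) auto
  finally have card_C: "card C \<le> t * (\<Prod>D\<leftarrow>Ds. card D)" by simp
  have C_sub: "C \<subseteq> code_words G (t * m)" by (auto simp: C_def K_def)
  have covered: "\<exists>c\<in>code_power G t (t * m) C. real (t_distance G t (t * m) c u) \<le> real (t * w)"
    if u: "u \<in> code_matrices G t (t * m)" for u
  proof -
    \<comment> \<open>The rows of block \<open>b\<close>, rotated so that position \<open>j\<close>
      is the row served by \<open>Ds ! j\<close>.\<close>
    define us where "us b = map (\<lambda>j. blk b (u ((j + b) mod t))) [0..<t]" for b
    have us_nth: "us b ! j = blk b (u ((j + b) mod t))" if "j < t" for b j
      using that by (simp add: us_def)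
    have "set (us b) \<subseteq> code_words G m" if "b < t" for b
    proof -
      have "blk b (u i) \<in> code_words G m" if "i < t" for i
        unfolding blk_def code_words_def restrict_PiE_iff
        using code_matrices_entry[OF u that pos[OF \<open>b < t\<close>]] by simp
      then show ?thesis using t1 by (auto simp: us_def)
    qed
    moreover have "length (us b) = t" for b by (simp add: us_def)
    ultimately have "\<forall>b<t. \<exists>es\<in>light_errors m w. \<forall>j<t. f (us b ! j) (es ! j) \<in> Ds ! j"
      using cover by blast
    then obtain es where es: "\<And>b. b < t \<Longrightarrow> es b \<in> light_errors m w"
      "\<And>b j. b < t \<Longrightarrow> j < t \<Longrightarrow> f (us b ! j) (es b ! j) \<in> Ds ! j" by metis
    \<comment> \<open>Each block of \<open>u\<close> is corrected by the error found for it, which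
      moves every row into its hitting set.\<close>
    define c where "c = (\<lambda>i\<in>{..<t}. \<lambda>p\<in>{..<t * m}.
      f (us (p div m) ! J i (p div m)) (es (p div m) ! J i (p div m)) (p mod m))"
    have blk_c: "blk b (c i) = f (us b ! J i b) (es b ! J i b)" if "i < t" "b < t" for i b
      using that pos by (auto simp: blk_def c_def f_def fun_eq_iff restrict_def)
    have c_in: "c i p \<in> carrier G" if "i < t" "p < t * m" for i p
    proof -
      have m0: "m > 0" using that(2) by (cases m) auto
      have b: "p div m < t" using that(2) m0 by (simp add: less_mult_imp_div_less)
      have "blk (p div m) (c i) \<in> code_words G m"
        unfolding blk_c[OF that(1) b] using es(2)[OF b Jt] fDs(2)[OF Jt] by blast
      then have "blk (p div m) (c i) (p mod m) \<in> carrier G"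
        using m0 by (auto simp: code_words_def PiE_iff)
      then show ?thesis using m0 by (simp add: blk_def)
    qed
    have c_K: "c i \<in> K i" if "i < t" for i
      using c_in that es(2) Jt blk_c unfolding K_def code_words_def
      by (auto simp: PiE_iff) (simp add: c_def)
    have c_mat: "c \<in> code_matrices G t (t * m)"
      using c_K unfolding code_matrices_def K_def by (auto simp: PiE_iff) (simp add: c_def)
    then have c_pow: "c \<in> code_power G t (t * m) C"
      using c_K by (auto simp: code_power_def C_def)
    define Z where "Z b = {k \<in> {..<m}. \<exists>j<t. (es b ! j) k \<noteq> \<one>}" for b
    \<comment> \<open>\<open>c\<close> and \<open>u\<close> differ only where an error entry is
      nontrivial, and each block has at most \<open>w\<close> such columns.\<close>
    have "{p \<in> {..<t * m}. \<exists>i<t. c i p \<noteq> u i p} \<subseteq> (\<Union>b<t. (\<lambda>k. b * m + k) ` Z b)"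
    proof
      fix p assume "p \<in> {p \<in> {..<t * m}. \<exists>i<t. c i p \<noteq> u i p}"
      then obtain i where p: "p < t * m" and i: "i < t" "c i p \<noteq> u i p" by blast
      define b k where "b = p div m" and "k = p mod m"
      have m0: "m > 0" using p by (cases m) auto
      have b: "b < t" and k: "k < m" and pbk: "p = b * m + k"
        using p m0 by (auto simp: b_def k_def less_mult_imp_div_less)
      have "c i p = blk b (c i) k" using k pbk by (simp add: blk_def)
      also have "\<dots> = f (us b ! J i b) (es b ! J i b) k" by (simp only: blk_c[OF i(1) b])
      also have "\<dots> = u i p \<otimes> inv ((es b ! J i b) k)"
        using k pbk J_add[OF i(1) b] by (simp add: f_def us_nth[OF Jt] blk_def)
      finally have "(es b ! J i b) k \<noteq> \<one>"
        using i code_matrices_entry[OF u i(1) p] by auto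
      then have "k \<in> Z b" using k Jt by (auto simp: Z_def)
      then show "p \<in> (\<Union>b<t. (\<lambda>k. b * m + k) ` Z b)" using b pbk by blast
    qed
    then have "t_distance G t (t * m) c u \<le> card (\<Union>b<t. (\<lambda>k. b * m + k) ` Z b)"
      unfolding t_distance_eq[OF c_mat u] by (intro card_mono) (auto simp: Z_def)
    also have "\<dots> \<le> (\<Sum>b<t. card ((\<lambda>k. b * m + k) ` Z b))" by (rule card_UN_le) simp
    also have "\<dots> = (\<Sum>b<t. card (Z b))" by (simp add: card_image)
    also have "\<dots> \<le> (\<Sum>b<t. w)"
      using es(1) by (intro sum_mono) (auto simp: Z_def light_errors_def)
    finally have "t_distance G t (t * m) c u \<le> t * w" by simp
    then have "real (t_distance G t (t * m) c u) \<le> real (t * w)" by (rule of_nat_mono)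
    then show ?thesis using c_pow by (rule bexI)
  qed
  have "C \<noteq> {}"
  proof -
    obtain u where "u \<in> code_matrices G t (t * m)" using code_matrices_nonempty by blast
    then obtain c where "c \<in> code_power G t (t * m) C" using covered by blast
    then show ?thesis using t1 by (auto simp: code_power_def)
  qed
  then have "C \<in> covering_codes (t * m) (real (t * w))"
    using C_sub covered covering_radius_le_iff[OF \<open>C \<noteq> {}\<close> C_sub] by blast
  with card_C show ?thesis by (rule bexI)
qed

text \<open>The degrees of the pruned tree multiply to nearly the number of light errors. Beyond
  \<open>q ^ (t * m)\<close> the right side is polynomial in \<open>m\<close>: the union factor, the
  pruning loss and the logarithmic factors of the hitting sets.\<close>

lemma covering_code_exists:
  assumes "w \<le> m"
  shows "\<exists>C\<in>covering_codes (t * m) (real (t * w)).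
    real (card C) * (real (m choose w) * (real (q ^ t) - 1) ^ w) \<le>
      real t * (real q ^ (t * m) * (2 * (real (q * m) + 1) ^ t) ^ t *
        (real (t * m) * ln (real q) + 1) ^ t)"
proof -
  define X where "X = code_words G m"
  define f where "f = (\<lambda>u x. \<lambda>k\<in>{..<m}. u k \<otimes> inv (x k))"
  define E where "E = light_errors m w"
  define L where "L = q * m"
  define M where "M = (2 * (L + 1) ^ t) ^ t"
  \<comment> \<open>The family starts with the single tree \<open>E\<close>, so
    \<open>card X ^ t\<close> is a sufficient bound.\<close>
  define B where "B = real (card X) ^ t"
  have X: "finite X" "card X = q ^ m" unfolding X_def by (rule finite_code_words, rule card_code_words)
  \<comment> \<open>A crude bound from \<open>q < 2 ^ q\<close>; it suffices that \<open>L\<close>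
    is linear in \<open>m\<close>.\<close>
  have "q ^ m \<le> (2 ^ q) ^ m" by (rule power_mono[OF less_imp_le[OF less_exp]]) simp
  then have XL: "card X \<le> 2 ^ L" by (simp add: X L_def power_mult)
  have E_sub: "E \<subseteq> {xs. set xs \<subseteq> X \<and> length xs = t}" by (auto simp: E_def X_def light_errors_def)
  define V where "V = (m choose w) * (q ^ t - 1) ^ w"
  have V: "V \<le> card E" unfolding V_def E_def by (rule card_light_errors_ge)
  have V0: "V > 0" using q_pow_t_ge assms by (simp add: V_def)
  then have "E \<noteq> {}" using V by auto
  from branching_subtree[OF X(1) XL order_refl E_sub this] obtain as where
    as: "length as = t" "branching X (map ((^) 2) as) E" "card E \<le> (\<Prod>a\<leftarrow>as. 2 ^ a) * M"
    unfolding M_def by blast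
  define ks :: "nat list" where "ks = map ((^) 2) as"
  have ks: "length ks = t" using as by (simp add: ks_def)
  have "q ^ m \<ge> 1" using q2 by simp
  then have B1: "1 \<le> B" unfolding B_def X(2) by (metis of_nat_1 of_nat_le_iff one_le_power)
  have f_in: "f u x \<in> X" if "u \<in> X" "x \<in> X" for u x
    using that by (auto simp: f_def X_def code_words_def restrict_PiE_iff PiE_iff)
  have f_inj: "inj_on (f u) X" if u: "u \<in> X" for u
  proof (rule inj_onI)
    fix x y assume xy: "x \<in> X" "y \<in> X" and eq: "f u x = f u y"
    have "x k = y k" if "k < m" for k
    proof -
      have "u k \<in> carrier G" "x k \<in> carrier G" "y k \<in> carrier G"
        using u xy that by (auto simp: X_def code_words_def)
      moreover have "u k \<otimes> inv (x k) = u k \<otimes> inv (y k)"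
        using fun_cong[OF eq, of k] that by (simp add: f_def)
      ultimately show ?thesis by (metis inv_closed inv_inv Units_eq Units_l_cancel)
    qed
    then show "x = y" using xy unfolding X_def code_words_def by (metis PiE_ext lessThan_iff)
  qed
  have "\<exists>Ds. length Ds = length ks \<and> (\<forall>D\<in>set Ds. D \<subseteq> X) \<and>
      (\<Prod>D\<leftarrow>Ds. real (card D)) \<le> (\<Prod>k\<leftarrow>ks. real (card X) / real k * (ln B + 1)) \<and>
      (\<forall>E'\<in>{E}. \<forall>us. set us \<subseteq> X \<and> length us = length ks \<longrightarrow>
        (\<exists>es\<in>E'. length es = length ks \<and> (\<forall>j<length ks. f (us ! j) (es ! j) \<in> Ds ! j)))"
    by (rule branching_cover[OF X(1) f_in f_inj B1]) (use as(2) ks in \<open>auto simp: ks_def B_def\<close>)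
  then obtain Ds where Ds: "length Ds = t" "\<forall>D\<in>set Ds. D \<subseteq> X"
    "(\<Prod>D\<leftarrow>Ds. real (card D)) \<le> (\<Prod>k\<leftarrow>ks. real (card X) / real k * (ln B + 1))"
    "\<forall>us. set us \<subseteq> X \<and> length us = t \<longrightarrow>
        (\<exists>es\<in>E. length es = t \<and> (\<forall>j<t. f (us ! j) (es ! j) \<in> Ds ! j))"
    unfolding ks by auto
  have cover: "\<exists>es\<in>E. \<forall>j<t. f (us ! j) (es ! j) \<in> Ds ! j" if "set us \<subseteq> X" "length us = t" for us
    using Ds(4) that by blast
  obtain C where C: "C \<in> covering_codes (t * m) (real (t * w))" "card C \<le> t * (\<Prod>D\<leftarrow>Ds. card D)"
    using block_code[OF Ds(1) Ds(2)[unfolded X_def] cover[unfolded f_def X_def E_def]] by blast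
  define P where "P = real (\<Prod>a\<leftarrow>as. 2 ^ a)"
  have P0: "P > 0" unfolding P_def by (induction as) auto
  have lB: "ln B = real (t * m) * ln (real q)"
    using q2 by (simp add: B_def X(2) ln_realpow)
  have "(\<Prod>k\<leftarrow>ks. real (card X) / real k * (ln B + 1)) = (real (card X) * (ln B + 1)) ^ length as / P"
    unfolding ks_def P_def by (induction as) auto
  then have prod_ks: "(\<Prod>k\<leftarrow>ks. real (card X) / real k * (ln B + 1)) = real q ^ (t * m) * (ln B + 1) ^ t / P"
    using as(1) by (simp add: X(2) power_mult_distrib power_mult[symmetric] mult.commute)
  have "real (card C) \<le> real t * (\<Prod>D\<leftarrow>Ds. real (card D))"
  proof -
    have "real (\<Prod>D\<leftarrow>Ds. card D) = (\<Prod>D\<leftarrow>Ds. real (card D))" by (induction Ds) auto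
    then show ?thesis using C(2) by (metis of_nat_le_iff of_nat_mult)
  qed
  also have "\<dots> \<le> real t * (real q ^ (t * m) * (ln B + 1) ^ t / P)"
    using Ds(3) unfolding prod_ks by (intro mult_left_mono) auto
  finally have cC: "real (card C) \<le> real t * (real q ^ (t * m) * (ln B + 1) ^ t / P)" .
  have "V \<le> (\<Prod>a\<leftarrow>as. 2 ^ a) * M" using V as(3) by linarith
  then have VP: "real V \<le> P * real M" unfolding P_def by (metis of_nat_le_iff of_nat_mult)
  \<comment> \<open>The product \<open>P\<close> of the degrees divides the bound for
    \<open>card C\<close> and multiplies the one for \<open>V\<close>, so it cancels.\<close>
  have "real (card C) * real V \<le> real t * (real q ^ (t * m) * (ln B + 1) ^ t / P) * (P * real M)"
    using cC VP B1 P0 by (intro mult_mono) auto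
  also have "\<dots> = real t * (real q ^ (t * m) * real M * (ln B + 1) ^ t)" using P0 by simp
  finally have *: "real (card C) * real V \<le> real t * (real q ^ (t * m) * real M * (ln B + 1) ^ t)" .
  have eV: "real V = real (m choose w) * (real (q ^ t) - 1) ^ w"
    using q_pow_t_ge by (simp add: V_def of_nat_diff)
  have eM: "real M = (2 * (real (q * m) + 1) ^ t) ^ t" by (simp add: M_def L_def add.commute)
  show ?thesis using *[unfolded eV eM lB] C(1) by (rule bexI)
qed

subsection \<open>The optimal rate\<close>

text \<open>Logarithms of all subexponential losses: the union of \<open>t\<close> codes, the
  pruning, the hitting sets and the Stirling factors.\<close>

definition log_overhead :: "nat \<Rightarrow> real" where
  "log_overhead m = ln (real t) + real t * (ln 2 + real t * ln (real (q * m) + 1)) +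
     real t * ln (real (t * m) * ln (real q) + 1) + 2 + 2 * ln (real m + 1)"

lemma log_overhead_tendsto: "(\<lambda>m. log_overhead m / (real (t * m) * ln (real q))) \<longlonglongrightarrow> 0"
proof -
  have "real t > 0" "real q > 0" "ln (real q) > 0" using t1 q2 by auto
  then show ?thesis unfolding log_overhead_def of_nat_mult by real_asymp
qed

text \<open>Logarithms of \<open>covering_code_exists\<close>, with the sphere size bounded below by
  entropy. A column alphabet of \<open>q ^ t\<close> letters scales the entropy by
  \<open>t * m\<close>, exactly the word length.\<close>

lemma min_log_size_block_le:
  assumes "w < m" "real w \<le> \<rho> * real m"
  shows "min_log_size G t (t * m) (\<rho> * real (t * m)) / real (t * m) \<le>
    1 - entropy_fun (q ^ t) (real w / real m) + log_overhead m / (real (t * m) * ln (real q))"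
proof -
  define H where "H = entropy_fun (q ^ t) (real w / real m)"
  define V where "V = real (m choose w) * (real (q ^ t) - 1) ^ w"
  define R where "R = real t * (real q ^ (t * m) * (2 * (real (q * m) + 1) ^ t) ^ t *
        (real (t * m) * ln (real q) + 1) ^ t)"
  have lnq: "ln (real q) > 0" using q2 by simp
  have tm: "real (t * m) > 0" using t1 assms by simp
  have "1 < real (q ^ t)" using q_pow_t_ge by linarith
  then have V0: "V > 0" using assms unfolding V_def by simp
  obtain C where C: "C \<in> covering_codes (t * m) (real (t * w))" "real (card C) * V \<le> R"
    using covering_code_exists[of w m] assms unfolding V_def R_def by auto
  have "real (t * w) \<le> \<rho> * real (t * m)"
    using mult_left_mono[OF assms(2), of "real t"] by (simp add: mult_ac)
  then have C': "C \<in> covering_codes (t * m) (\<rho> * real (t * m))" using C(1) by auto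
  have "finite C" using C(1) finite_code_words finite_subset by auto
  then have cC: "real (card C) > 0" using C(1) by (auto simp: card_gt_0_iff)
  have p: "real (t * m) * ln (real q) + 1 > 0" using lnq tm by (simp add: add_pos_pos)
  have "ln (real (card C)) + ln V = ln (real (card C) * V)" using cC V0 by (simp add: ln_mult)
  also have "\<dots> \<le> ln R" using C(2) cC V0 by (intro ln_mono) auto
  also have "\<dots> = ln (real t) + (real (t * m) * ln (real q) +
      real t * (ln 2 + real t * ln (real (q * m) + 1)) + real t * ln (real (t * m) * ln (real q) + 1))"
  proof -
    have "real (q * m) + 1 > 0" by (simp add: add_nonneg_pos)
    then show ?thesis
      using t1 q2 p unfolding R_def
      by (simp add: ln_mult ln_realpow distrib_left del: of_nat_mult)
  qed
  finally have 1: "ln (real (card C)) + ln V \<le> ln (real t) + (real (t * m) * ln (real q) +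
      real t * (ln 2 + real t * ln (real (q * m) + 1)) + real t * ln (real (t * m) * ln (real q) + 1))" .
  have 2: "real m * H * (real t * ln (real q)) - 2 - 2 * ln (real m + 1) \<le> ln V"
    using ln_sphere_size_ge[OF assms(1) q_pow_t_ge] q2 unfolding V_def H_def
    by (simp add: ln_realpow add.commute)
  have "ln (real (card C)) \<le> real (t * m) * ln (real q) * (1 - H) + log_overhead m"
    using 1 2 by (simp add: log_overhead_def algebra_simps)
  then have "ln (real (card C)) / (real (t * m) * ln (real q)) \<le>
      (real (t * m) * ln (real q) * (1 - H) + log_overhead m) / (real (t * m) * ln (real q))"
    using tm lnq by (intro divide_right_mono) auto
  also have "\<dots> = 1 - H + log_overhead m / (real (t * m) * ln (real q))"
    using tm lnq by (simp add: add_divide_distrib del: of_nat_mult)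
  finally have "log (real q) (real (card C)) / real (t * m) \<le>
      1 - H + log_overhead m / (real (t * m) * ln (real q))"
    by (simp add: log_def mult.commute)
  moreover have "min_log_size G t (t * m) (\<rho> * real (t * m)) / real (t * m) \<le>
      log (real q) (real (card C)) / real (t * m)"
    using min_log_size_le[OF C'] by (rule divide_right_mono) simp
  ultimately show ?thesis unfolding H_def by linarith
qed

lemma entropy_floor_tendsto:
  assumes "0 \<le> \<rho>" "\<rho> < 1"
  shows "(\<lambda>m. entropy_fun (q ^ t) (real (nat \<lfloor>\<rho> * real m\<rfloor>) / real m)) \<longlonglongrightarrow> entropy_fun (q ^ t) \<rho>"
\<comment> \<open>Continuity was shown only inside the unit interval; at 0 the sequence is
  constant.\<close>
proof (cases "\<rho> = 0")
  case False
  have "isCont (entropy_fun (q ^ t)) \<rho>"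
    by (rule isCont_entropy_fun[OF q_pow_t_ge]) (use assms False in auto)
  moreover have "(\<lambda>m. real (nat \<lfloor>\<rho> * real m\<rfloor>) / real m) \<longlonglongrightarrow> \<rho>"
    using floor_mult_div_tendsto[of \<rho>] assms by simp
  ultimately show ?thesis by (rule isCont_tendsto_compose)
qed simp

text \<open>A lower limit is at most the one along a subsequence, so codes of the lengths
  \<open>t * m\<close> suffice.\<close>

lemma min_rate_le_entropy:
  assumes "0 \<le> \<rho>" "\<rho> < 1"
  shows "min_rate G t \<rho> \<le> ereal (1 - entropy_fun (q ^ t) \<rho>)"
proof -
  define X where "X = (\<lambda>n. ereal (min_log_size G t n (\<rho> * real n) / real n))"
  define g where "g m = 1 - entropy_fun (q ^ t) (real (nat \<lfloor>\<rho> * real m\<rfloor>) / real m) +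
    log_overhead m / (real (t * m) * ln (real q))" for m
  have "g \<longlonglongrightarrow> 1 - entropy_fun (q ^ t) \<rho> + 0"
    unfolding g_def by (intro tendsto_intros entropy_floor_tendsto log_overhead_tendsto assms)
  then have lim: "(\<lambda>m. ereal (g m)) \<longlonglongrightarrow> ereal (1 - entropy_fun (q ^ t) \<rho>)" by simp
  have le: "(X \<circ> (\<lambda>m. t * m)) m \<le> ereal (g m)" if "m \<ge> 1" for m
  proof -
    \<comment> \<open>\<open>\<rho> < 1\<close> makes the radius per block strictly less than
      \<open>m\<close>, as the sphere estimate requires.\<close>
    have "\<rho> * real m < 1 * real m" using assms that by (intro mult_strict_right_mono) auto
    then have "real_of_int \<lfloor>\<rho> * real m\<rfloor> < real m" by linarith
    then have "\<lfloor>\<rho> * real m\<rfloor> < int m" by linarith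
    then have "nat \<lfloor>\<rho> * real m\<rfloor> < m" using that by linarith
    moreover have "real (nat \<lfloor>\<rho> * real m\<rfloor>) \<le> \<rho> * real m" using assms by simp
    ultimately have "nat \<lfloor>\<rho> * real m\<rfloor> < m \<and> real (nat \<lfloor>\<rho> * real m\<rfloor>) \<le> \<rho> * real m" ..
    from min_log_size_block_le[OF conjunct1[OF this] conjunct2[OF this]] show ?thesis by (simp only: X_def g_def comp_def ereal_less_eq)
  qed
  have "strict_mono (\<lambda>m. t * m)" using t1 by (auto simp: strict_mono_def)
  then have "liminf X \<le> liminf (X \<circ> (\<lambda>m. t * m))" by (rule liminf_subseq_mono)
  also have "\<dots> \<le> liminf (\<lambda>m. ereal (g m))"
    by (rule Liminf_mono) (use le in \<open>auto simp: eventually_at_top_linorder\<close>)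
  also have "\<dots> = ereal (1 - entropy_fun (q ^ t) \<rho>)"
    using lim by (intro lim_imp_Liminf) auto
  finally show ?thesis unfolding min_rate_def X_def .
qed

lemma min_rate_ge_entropy:
  assumes "0 \<le> \<rho>" "\<rho> < 1 - 1 / real q ^ t"
  shows "ereal (1 - entropy_fun (q ^ t) \<rho>) \<le> min_rate G t \<rho>"
  unfolding min_rate_def
proof (rule Liminf_bounded, unfold eventually_at_top_linorder, intro exI[of _ 1] allI impI)
  fix n :: nat assume "n \<ge> 1"
  have "real n * (1 - entropy_fun (q ^ t) \<rho>) \<le> min_log_size G t n (\<rho> * real n)"
    using assms by (intro min_log_size_ge sphere_covering_bound) auto
  then show "ereal (1 - entropy_fun (q ^ t) \<rho>) \<le> ereal (min_log_size G t n (\<rho> * real n) / real n)"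
    using \<open>n \<ge> 1\<close> by (simp add: field_simps)
qed

lemma min_rate_nonneg:
  assumes "0 \<le> \<rho>"
  shows "0 \<le> min_rate G t \<rho>"
  unfolding min_rate_def
proof (rule Liminf_bounded, rule always_eventually, rule allI)
  fix n
  have "0 \<le> log (real q) (real (card C))" if "C \<in> covering_codes n (\<rho> * real n)" for C
  proof -
    have "finite C" using that finite_code_words finite_subset by auto
    then have "card C \<ge> 1" using that by (auto simp: card_gt_0_iff Suc_le_eq)
    then show ?thesis using q2 by simp
  qed
  then have "0 \<le> min_log_size G t n (\<rho> * real n)" using assms by (intro min_log_size_ge) auto
  then show "0 \<le> ereal (min_log_size G t n (\<rho> * real n) / real n)" by simp
qed

text \<open>Codes of at most \<open>q\<close> words have rate at most \<open>1 / n\<close>.\<close>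

lemma min_rate_le_zero:
  assumes "1 - 1 / real q ^ t \<le> \<rho>"
  shows "min_rate G t \<rho> \<le> 0"
proof -
  have "min_log_size G t n (\<rho> * real n) \<le> 1" for n
  proof -
    obtain C where C: "C \<in> covering_codes n (\<rho> * real n)" "card C \<le> q"
      using repetition_code[OF assms] by (rule bexE)
    have "finite C" using C(1) finite_code_words finite_subset by auto
    then have "real (card C) > 0" using C(1) by (auto simp: card_gt_0_iff)
    then have "log (real q) (real (card C)) \<le> log (real q) (real q)"
      using C(2) q2 by (subst log_le_cancel_iff) auto
    then show ?thesis using min_log_size_le[OF C(1)] q2 by simp
  qed
  then have "min_rate G t \<rho> \<le> liminf (\<lambda>n. ereal (1 / real n))"
    unfolding min_rate_def by (intro Liminf_mono always_eventually allI) (simp add: divide_right_mono)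
  also have "\<dots> = ereal 0"
    using lim_1_over_n by (intro lim_imp_Liminf) auto
  finally show ?thesis by (simp add: zero_ereal_def)
qed

end

theorem theorem1:
  fixes G :: "('a, 'b) monoid_scheme" and q t :: nat and \<rho> :: real
  assumes "comm_group G"
    and "card (carrier G) = q"
    and "q \<ge> 2"
    and "t \<ge> 1"
    and "0 \<le> \<rho>" and "\<rho> \<le> 1"
  shows "min_rate G t \<rho> =
    (if \<rho> < 1 - 1 / real q ^ t then ereal (1 - entropy_fun (q ^ t) \<rho>) else 0)"
proof -
  interpret comm_group G by fact
  interpret covering_alphabet G q t by unfold_locales fact+
  show ?thesis
  proof (cases "\<rho> < 1 - 1 / real q ^ t")
    case True
    have "1 / real q ^ t > 0" using \<open>q \<ge> 2\<close> by simp
    with True have "\<rho> < 1" by linarith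
    then show ?thesis
      using True min_rate_le_entropy min_rate_ge_entropy \<open>0 \<le> \<rho>\<close> by (simp add: antisym)
  next
    case False
    then show ?thesis using min_rate_le_zero min_rate_nonneg \<open>0 \<le> \<rho>\<close> by (simp add: antisym)
  qed
qed

end
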